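(* Let $n=n_1n_2$ be a square-free odd integer which is divisible by neither $7$ nor $13$, where $n_1=\prod_{i=1}^r p_i$ and $n_2=\prod_{j=1}^s q_j$ with primes $p_i\equiv 1 \pmod 3$ and $q_j\equiv 2\pmod 3$. Let $S$ be a sequence over $\mathbb{Z}_n$ of length $\ell=D_{T_n}(\mathbb{Z}_n)-1=2\Omega(n_1)+\Omega(n_2)$ such that $S$ has no non-empty $T_n$-weighted zero-sum subsequence. Then $S$ is equivalent with respect to $T_n$ to a sequence $x_1\cdot x_2\cdots x_\ell$ for which one of the following holds: Case 1: There is a prime divisor $p$ of $n_1$ such that $p$ divides every term $x_i$ except exactly two, namely $x_1$ and $x_2$; writing $n'=n/p$ and $x_i=py_i$ for $3\le i\le \ell$ (with $y_i\in\mathbb{Z}_{n'}$), the sequence $y_3\cdot y_4\cdots y_\ell$ over $\mathbb{Z}_{n'}$ is a $T_{n'}$-extremal sequence in $\mathbb{Z}_{n'}$, and the image of $x_1\cdot x_2$ under the natural map $\mathbb{Z}_n\to\mathbb{Z}_p$ is $T_p$-extremal. Case 2: There is a prime divisor $p$ of $n_2$ such that $p$ divides every term $x_i$ except exactly one, namely $x_1$; writing $n'=n/p$ and $x_i=py_i$ for $2\le i\le\ell$, the sequence $y_2\cdot y_3\cdots y_\ell$ over $\mathbb{Z}_{n'}$ is a $T_{n'}$-extremal sequence in $\mathbb{Z}_{n'}$.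
   Context: $\mathbb{Z}_m=\mathbb{Z}/m\mathbb{Z}$, $\mathbb{Z}_m^*$ its unit group, and $T_m=\{a^3\bmod m: a\in\mathbb{Z}_m^*\}$ (the set of cubes of units). $\Omega(m)$ is the number of prime factors of $m$ counted with multiplicity. A sequence over $\mathbb{Z}_m$ is a finite unordered list (multiset) of elements of $\mathbb{Z}_m$; subsequences are sub-multisets. For a weight set $A\subseteq\mathbb{Z}_m$, a sequence $x_1\cdots x_k$ is an $A$-weighted zero-sum sequence if there are $a_1,\dots,a_k\in A$ with $\sum a_ix_i=0$ in $\mathbb{Z}_m$. $D_A(\mathbb{Z}_m)$ is the least positive integer $\ell$ such that every sequence over $\mathbb{Z}_m$ of length $\ell$ has a non-empty $A$-weighted zero-sum subsequence. An $A$-extremal sequence in $\mathbb{Z}_m$ is a sequence over $\mathbb{Z}_m$ of length $D_A(\mathbb{Z}_m)-1$ with no non-empty $A$-weighted zero-sum subsequence. For a subgroup $A$ of $\mathbb{Z}_m^*$, two sequences $x_1\cdots x_k$ and $y_1\cdots y_k$ over $\mathbb{Z}_m$ are equivalent with respect to $A$ if there are $a_1,\dots,a_k\in A$, $c\in\mathbb{Z}_m^*$ and a permutation $\sigma$ of $\{1,\dots,k\}$ with $y_i=c\,a_i\,x_{\sigma(i)}$ for all $i$. For a prime $p$, $D_{T_p}(\mathbb{Z}_p)=3$ if $p\equiv1\pmod 3$, so a $T_p$-extremal sequence then has length $2$. *)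

theory Defs
  imports "HOL-Number_Theory.Number_Theory" "HOL-Computational_Algebra.Squarefree"
    "HOL-Library.Multiset" "HOL-Combinatorics.Permutations"
begin

text \<open>
  For \<open>m \<ge> 1\<close>, the ring \<open>\<int>/m\<int>\<close> is represented by its canonical residues \<open>0, \<dots>, m - 1\<close>.
  The trivial ring \<open>m = 1\<close> is needed as well, as the case \<open>n' = n / p = 1\<close>.  The library's
  \<open>residue_ring\<close> is not used because its one-element is \<open>1\<close> even for \<open>m = 1\<close>, so that
  \<open>residue_ring 1\<close> would have no units, whereas the unit group of the zero ring is \<open>{0}\<close>.
\<close>

definition Zmod :: "int \<Rightarrow> int set" where
  "Zmod m = {0..<m}"

definition Zmod_units :: "int \<Rightarrow> int set" where
  "Zmod_units m = {a \<in> Zmod m. \<exists>b \<in> Zmod m. [a * b = 1] (mod m)}"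

definition unit_cubes :: "int \<Rightarrow> int set" where
  "unit_cubes m = {a ^ 3 mod m | a. a \<in> Zmod_units m}"

definition Omega :: "int \<Rightarrow> nat" where
  "Omega m = size (prime_factorization m)"

definition sequence_over :: "int \<Rightarrow> int multiset \<Rightarrow> bool" where
  "sequence_over m S \<longleftrightarrow> set_mset S \<subseteq> Zmod m"

definition weighted_zero_sum :: "int \<Rightarrow> int set \<Rightarrow> int multiset \<Rightarrow> bool" where
  "weighted_zero_sum m A S \<longleftrightarrow>
     (\<exists>xs as. mset xs = S \<and> length as = length xs \<and> set as \<subseteq> A \<and>
        [(\<Sum>i<length xs. as ! i * xs ! i) = 0] (mod m))"

definition has_zero_sum_subsequence :: "int \<Rightarrow> int set \<Rightarrow> int multiset \<Rightarrow> bool" where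
  "has_zero_sum_subsequence m A S \<longleftrightarrow>
     (\<exists>R. R \<subseteq># S \<and> R \<noteq> {#} \<and> weighted_zero_sum m A R)"

definition davenport :: "int \<Rightarrow> int set \<Rightarrow> nat" where
  "davenport m A =
     (LEAST l. 0 < l \<and>
        (\<forall>S. sequence_over m S \<and> size S = l \<longrightarrow> has_zero_sum_subsequence m A S))"

definition extremal_sequence :: "int \<Rightarrow> int set \<Rightarrow> int multiset \<Rightarrow> bool" where
  "extremal_sequence m A S \<longleftrightarrow>
     sequence_over m S \<and> size S = davenport m A - 1 \<and> \<not> has_zero_sum_subsequence m A S"

definition equivalent_sequences ::
    "int \<Rightarrow> int set \<Rightarrow> int multiset \<Rightarrow> int multiset \<Rightarrow> bool" where
  "equivalent_sequences m A X Y \<longleftrightarrow>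
     (\<exists>xs ys as c \<sigma>. mset xs = X \<and> mset ys = Y \<and>
        length ys = length xs \<and> length as = length xs \<and>
        set as \<subseteq> A \<and> c \<in> Zmod_units m \<and> \<sigma> permutes {..<length xs} \<and>
        (\<forall>i<length xs. ys ! i = (c * as ! i * xs ! \<sigma> i) mod m))"

end

theory Submission
  imports Defs
begin

text \<open>
  If for every prime \<open>p\<close> dividing \<open>n\<close> more than \<open>w(p)\<close> terms of a sequence are prime to \<open>p\<close>, where
  \<open>w(p) = 2\<close> for \<open>p \<equiv> 1 (mod 3)\<close> and \<open>w(p) = 1\<close> for \<open>p \<equiv> 2 (mod 3)\<close>, then the whole sequence is a
  weighted zero-sum sequence: by the Chinese remainder theorem this is a question modulo each \<open>p\<close>,
  where \<open>w(p) + 1\<close> units already represent every residue.  For \<open>p \<equiv> 2\<close> this holds because all units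
  are cubes.  For \<open>p \<equiv> 1\<close> it amounts to the positivity of the cyclotomic numbers of order three, which
  follows from their linear and quadratic relations as soon as \<open>p \<ge> 19\<close>; the excluded primes \<open>7\<close>
  and \<open>13\<close> are exactly those for which it fails.

  Hence a zero-sum free sequence has at most \<open>w(p)\<close> terms prime to some \<open>p\<close>, and dividing the remaining
  terms by \<open>p\<close> gives a zero-sum free sequence modulo \<open>n / p\<close>.  By induction the maximal length is
  \<open>\<Sum> w(p)\<close>, and at that length exactly \<open>w(p)\<close> terms are prime to \<open>p\<close>.  If some of these had a weighted
  zero sum modulo \<open>p\<close>, their combination would be a further multiple of \<open>p\<close>, making the sequence
  modulo \<open>n / p\<close> too long.
\<close>

section \<open>Sums of cubes modulo a prime\<close>

locale cubic_residues =
  fixes p g :: int and t :: nat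
  assumes prime_p: "prime p" and p_eq: "p = 3 * int t + 1"
    and generator: "bij_betw (\<lambda>k. g ^ k mod p) {..<3 * t} {1..<p}"
begin

text \<open>The constant \<open>v\<close> stands on the same side as the two cubes so that the count
  becomes symmetric in all three arguments.\<close>

definition representations :: "int \<Rightarrow> int \<Rightarrow> int \<Rightarrow> int" where
  "representations a b v =
     (\<Sum>x\<in>{1..<p}. \<Sum>y\<in>{1..<p}. of_bool (p dvd a * x ^ 3 + b * y ^ 3 + v))"

lemma p_gt_1: "p > 1"
  using prime_p prime_gt_1_int by blast

lemma t_pos: "t > 0"
  using p_gt_1 p_eq by auto

lemma p_minus_1 [simp]: "p - 1 = 3 * int t"
  using p_eq by simp

lemma p_pos [simp]: "p > 0"
  using p_gt_1 by simp

lemma not_dvd_unit: "x \<in> {1..<p} \<Longrightarrow> \<not> p dvd x"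
  using zdvd_not_zless by auto

lemma mod_unit_mem: "\<not> p dvd a \<Longrightarrow> a mod p \<in> {1..<p}"
  using pos_mod_sign[OF p_pos, of a] pos_mod_bound[OF p_pos, of a] dvd_eq_mod_eq_0[of p a]
  unfolding atLeastLessThan_iff by linarith

lemma cong_mod_self: "[a mod p = a] (mod p)"
  by (simp add: cong_def)

lemma generator_not_dvd: "\<not> p dvd g"
proof
  assume "p dvd g"
  show False
  proof (cases "t = 0")
    case False
    then have "1 \<in> {..<3 * t}" by auto
    then have "g ^ 1 mod p \<in> {1..<p}"
      using bij_betwE[OF generator] by blast
    with \<open>p dvd g\<close> show False by auto
  qed (use t_pos in auto)
qed

lemma not_dvd_generator_power: "\<not> p dvd g ^ k"
  using generator_not_dvd prime_p prime_dvd_power by blast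

lemma generator_log:
  assumes "\<not> p dvd a"
  obtains k where "k < 3 * t" "[a = g ^ k] (mod p)"
proof -
  have "a mod p \<in> (\<lambda>k. g ^ k mod p) ` {..<3 * t}"
    using bij_betw_imp_surj_on[OF generator] mod_unit_mem[OF assms] by simp
  then obtain k where "k < 3 * t" "g ^ k mod p = a mod p" by auto
  then show thesis using that by (auto simp: cong_def)
qed

text \<open>\<open>g ^ (3 * t)\<close> is a unit, hence congruent to some \<open>g ^ k\<close> with
  \<open>k < 3 * t\<close>. If \<open>k\<close> were positive, cancelling one factor
  \<open>g\<close> would give the same power for the exponents \<open>3 * t - 1\<close> and
  \<open>k - 1\<close>, against injectivity.\<close>

lemma generator_order: "[g ^ (3 * t) = 1] (mod p)"
proof -
  obtain k where k: "k < 3 * t" "[g ^ (3 * t) = g ^ k] (mod p)"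
    using generator_log not_dvd_generator_power by blast
  have "k = 0"
  proof (rule ccontr)
    assume "k \<noteq> 0"
    then have "g ^ k = g * g ^ (k - 1)" "g ^ (3 * t) = g * g ^ (3 * t - 1)"
      using t_pos by (subst power_eq_if, simp)+
    then have "[g * g ^ (3 * t - 1) = g * g ^ (k - 1)] (mod p)"
      using k by metis
    then have "g ^ (3 * t - 1) mod p = g ^ (k - 1) mod p"
      using cong_mult_lcancel[of g p] prime_imp_coprime[OF prime_p generator_not_dvd]
      by (simp add: cong_def coprime_commute)
    moreover have "3 * t - 1 \<in> {..<3 * t}" "k - 1 \<in> {..<3 * t}" using k t_pos by auto
    ultimately have "3 * t - 1 = k - 1"
      using generator unfolding bij_betw_def inj_on_def by blast
    with k \<open>k \<noteq> 0\<close> show False by simp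
  qed
  with k show ?thesis by simp
qed

lemma bij_betw_unit_scale:
  assumes "\<not> p dvd u"
  shows "bij_betw (\<lambda>x. u * x mod p) {1..<p} {1..<p}"
proof -
  have "inj_on (\<lambda>x. u * x mod p) {1..<p}"
  proof (rule inj_onI)
    fix x y assume xy: "x \<in> {1..<p}" "y \<in> {1..<p}" "u * x mod p = u * y mod p"
    then have "p dvd u * (x - y)"
      by (simp add: mod_eq_dvd_iff right_diff_distrib)
    then have "p dvd x - y"
      using assms prime_p by (simp add: prime_dvd_mult_iff)
    then have "x mod p = y mod p" by (simp add: mod_eq_dvd_iff)
    with xy show "x = y" by simp
  qed
  moreover have "(\<lambda>x. u * x mod p) ` {1..<p} \<subseteq> {1..<p}"
  proof (rule image_subsetI)
    fix x assume "x \<in> {1..<p}"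
    then have "\<not> p dvd u * x"
      using assms prime_p not_dvd_unit by (simp add: prime_dvd_mult_iff)
    then show "u * x mod p \<in> {1..<p}" by (rule mod_unit_mem)
  qed
  ultimately show ?thesis
    by (simp add: bij_betw_def endo_inj_surj)
qed

lemma sum_unit_scale:
  fixes f :: "int \<Rightarrow> int"
  assumes "\<not> p dvd u" and "\<And>v. f (v mod p) = f v"
  shows "(\<Sum>x\<in>{1..<p}. f (u * x)) = (\<Sum>x\<in>{1..<p}. f x)"
  using sum.reindex_bij_betw[OF bij_betw_unit_scale[OF assms(1)], of f] assms(2) by simp

text \<open>The powers of \<open>g ^ 3\<close> are the nonzero cubes. Their three cosets,
  represented by 1, \<open>g\<close> and \<open>g ^ 2\<close>, have \<open>t\<close> elements each,
  and \<open>h\<close> is constant on each of them.\<close>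

lemma sum_units_cube_invariant:
  fixes h :: "int \<Rightarrow> int"
  assumes per: "\<And>v. h (v mod p) = h v" and inv: "\<And>v. h (v * g ^ 3) = h v"
  shows "(\<Sum>v\<in>{1..<p}. h v) = int t * (h 1 + h g + h (g ^ 2))"
proof -
  \<comment> \<open>Exponents are summed in blocks of three; each block meets every coset
    once.\<close>
  have "(\<Sum>k<3 * n. h (g ^ k)) = int n * (h 1 + h g + h (g ^ 2))" for n
  proof (induction n)
    case (Suc n)
    have *: "h (g ^ (3 * n + j)) = h (g ^ j)" for j
    proof (induction n)
      case (Suc n)
      have "g ^ (3 * Suc n + j) = g ^ (3 * n + j) * g ^ 3"
        using power_add[of g "3 * n + j" 3] by (simp add: ac_simps)
      then show ?case using Suc inv by simp
    qed simp
    have "3 * Suc n = Suc (Suc (Suc (3 * n)))" by simp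
    then have "{..<3 * Suc n} = insert (3 * n + 2) (insert (3 * n + 1) (insert (3 * n + 0) {..<3 * n}))"
      by auto
    then have "(\<Sum>k<3 * Suc n. h (g ^ k)) =
        (\<Sum>k<3 * n. h (g ^ k)) + h (g ^ (3 * n + 0)) + h (g ^ (3 * n + 1)) + h (g ^ (3 * n + 2))"
      by simp
    also have "\<dots> = int (Suc n) * (h 1 + h g + h (g ^ 2))"
      unfolding * using Suc by (simp add: algebra_simps)
    finally show ?case .
  qed simp
  moreover have "(\<Sum>v\<in>{1..<p}. h v) = (\<Sum>k<3 * t. h (g ^ k))"
    using sum.reindex_bij_betw[OF generator, of h] per by simp
  ultimately show ?thesis by simp
qed

section \<open>Symmetries of the number of representations\<close>

lemma representations_cong:
  assumes "[a = a'] (mod p)" "[b = b'] (mod p)" "[v = v'] (mod p)"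
  shows "representations a b v = representations a' b' v'"
proof -
  have "p dvd a * x ^ 3 + b * y ^ 3 + v \<longleftrightarrow> p dvd a' * x ^ 3 + b' * y ^ 3 + v'" for x y
    by (rule cong_dvd_iff) (intro cong_add cong_mult cong_refl assms)
  then show ?thesis by (simp add: representations_def)
qed

lemma representations_nonneg: "representations a b v \<ge> 0"
  by (simp add: representations_def sum_nonneg)

lemma representations_commute: "representations a b v = representations b a v"
  unfolding representations_def by (subst sum.swap) (simp add: algebra_simps)

lemma representations_scale:
  assumes "\<not> p dvd l"
  shows "representations (l * a) (l * b) (l * v) = representations a b v"
proof -
  have "p dvd l * a * x ^ 3 + l * b * y ^ 3 + l * v \<longleftrightarrow> p dvd a * x ^ 3 + b * y ^ 3 + v" for x y
  proof -
    have "l * a * x ^ 3 + l * b * y ^ 3 + l * v = l * (a * x ^ 3 + b * y ^ 3 + v)"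
      by (simp add: algebra_simps)
    then show ?thesis using assms prime_p by (simp add: prime_dvd_mult_iff)
  qed
  then show ?thesis by (simp add: representations_def)
qed

text \<open>Multiplication by \<open>u\<close> permutes the nonzero residues, so \<open>x\<close>
  may be replaced by \<open>u * x\<close>.\<close>

lemma representations_cube1:
  assumes "\<not> p dvd u"
  shows "representations (a * u ^ 3) b v = representations a b v"
proof -
  define f where "f x = (\<Sum>y\<in>{1..<p}. of_bool (p dvd a * x ^ 3 + b * y ^ 3 + v) :: int)" for x
  have "p dvd a * (x mod p) ^ 3 + b * y ^ 3 + v \<longleftrightarrow> p dvd a * x ^ 3 + b * y ^ 3 + v" for x y
    by (rule cong_dvd_iff) (intro cong_add cong_mult cong_pow cong_refl cong_mod_self)
  then have "f (x mod p) = f x" for x by (simp add: f_def)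
  from sum_unit_scale[of u f, OF assms this] show ?thesis
    by (simp add: representations_def f_def power_mult_distrib mult.assoc)
qed

text \<open>Factors \<open>u ^ 3\<close> at \<open>a\<close> and \<open>b\<close> are absorbed by
  the variables; with them in place, \<open>u ^ 3\<close> is a common factor of the equation and
  cancels.\<close>

lemma representations_cube3:
  assumes "\<not> p dvd u"
  shows "representations a b (v * u ^ 3) = representations a b v"
proof -
  have "representations a b (v * u ^ 3) = representations (a * u ^ 3) (b * u ^ 3) (v * u ^ 3)"
    using assms representations_cube1 representations_commute by metis
  also have "\<dots> = representations a b v"
    using representations_scale[of "u ^ 3" a b v] assms prime_p prime_dvd_power[of p u 3]
    by (auto simp: mult.commute)
  finally show ?thesis .
qed

text \<open>-1 is its own cube.\<close>

lemma representations_minus: "representations a b (- v) = representations a b v"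
  using representations_cube3[of "-1" a b v] p_gt_1 by simp

text \<open>A third unit variable in \<open>c * z ^ 3\<close> multiplies the count by
  \<open>3 * t\<close>, and the homogeneous equation
  \<open>a * x ^ 3 + b * y ^ 3 + c * z ^ 3 = 0\<close> treats the three coefficients alike.\<close>

lemma representations_rotate: "representations a b c = representations c b a"
proof -
  have "int (3 * t) * representations a b c = (\<Sum>z\<in>{1..<p}. representations a b (c * z ^ 3))"
    using representations_cube3 not_dvd_unit by simp
  also have "\<dots> = (\<Sum>x\<in>{1..<p}. representations c b (a * x ^ 3))"
    unfolding representations_def by (subst sum.swap) (simp add: algebra_simps)
  also have "\<dots> = int (3 * t) * representations c b a"
    using representations_cube3 not_dvd_unit by simp
  finally show ?thesis using t_pos by simp
qed

section \<open>Cubes, non-cubes and cube roots\<close>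

lemma generator_power_not_cube:
  assumes "k mod 3 \<noteq> 0"
  shows "\<not> [x ^ 3 = g ^ k] (mod p)"
proof
  assume x: "[x ^ 3 = g ^ k] (mod p)"
  then have "\<not> p dvd x ^ 3" using cong_dvd_iff not_dvd_generator_power by blast
  then have "\<not> p dvd x" using prime_p by (simp add: prime_dvd_power_iff)
  then obtain j where "[x = g ^ j] (mod p)" by (rule generator_log)
  then have "[x ^ 3 = (g ^ j) ^ 3] (mod p)" by (rule cong_pow)
  then have *: "[g ^ (3 * j) = g ^ k] (mod p)"
    using x by (metis cong_sym cong_trans mult.commute power_mult)
  \<comment> \<open>Exponents are brought below \<open>3 * t\<close>, where powers of
    \<open>g\<close> are distinct. Since 3 divides \<open>3 * t\<close>, their class modulo 3 is
    kept.\<close>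
  have red: "[g ^ i = g ^ (i mod (3 * t))] (mod p)" for i
  proof -
    have "[(g ^ (3 * t)) ^ (i div (3 * t)) * g ^ (i mod (3 * t)) =
        1 ^ (i div (3 * t)) * g ^ (i mod (3 * t))] (mod p)"
      by (intro cong_mult cong_pow generator_order cong_refl)
    then show ?thesis
      by (simp flip: power_mult power_add)
  qed
  have "g ^ (3 * j mod (3 * t)) mod p = g ^ (k mod (3 * t)) mod p"
    using red[of "3 * j"] red[of k] * unfolding cong_def by simp
  moreover have "inj_on (\<lambda>k. g ^ k mod p) {..<3 * t}"
    using generator by (simp add: bij_betw_def)
  ultimately have "3 * j mod (3 * t) = k mod (3 * t)"
    using t_pos by (auto dest!: inj_onD)
  then have "3 * j mod (3 * t) mod 3 = k mod (3 * t) mod 3" by simp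
  then show False using assms by (simp add: mod_mod_cancel)
qed

definition cube_roots :: "int \<Rightarrow> int" where
  "cube_roots v = (\<Sum>x\<in>{1..<p}. of_bool (p dvd x ^ 3 - v))"

lemma cube_roots_mod: "cube_roots (v mod p) = cube_roots v"
proof -
  have "p dvd x ^ 3 - v mod p \<longleftrightarrow> p dvd x ^ 3 - v" for x
    by (rule cong_dvd_iff) (intro cong_diff cong_refl cong_mod_self)
  then show ?thesis by (simp add: cube_roots_def)
qed

lemma cube_roots_cube:
  assumes "\<not> p dvd u"
  shows "cube_roots (v * u ^ 3) = cube_roots v"
proof -
  define f where "f x = (of_bool (p dvd x ^ 3 - v * u ^ 3) :: int)" for x
  have "p dvd (x mod p) ^ 3 - v * u ^ 3 \<longleftrightarrow> p dvd x ^ 3 - v * u ^ 3" for x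
    by (rule cong_dvd_iff) (intro cong_diff cong_pow cong_refl cong_mod_self)
  then have "f (x mod p) = f x" for x by (simp add: f_def)
  from sum_unit_scale[of u f, OF assms this]
  have "cube_roots (v * u ^ 3) = (\<Sum>x\<in>{1..<p}. of_bool (p dvd u ^ 3 * (x ^ 3 - v)))"
    by (simp add: cube_roots_def f_def power_mult_distrib algebra_simps)
  also have "\<dots> = cube_roots v"
    using assms prime_p by (simp add: cube_roots_def prime_dvd_mult_iff prime_dvd_power_iff)
  finally show ?thesis .
qed

lemma cube_roots_generator: "k mod 3 \<noteq> 0 \<Longrightarrow> cube_roots (g ^ k) = 0"
  using generator_power_not_cube by (simp add: cube_roots_def cong_iff_dvd_diff)

text \<open>The pairs of a unit and its cube are counted twice: there are \<open>3 * t\<close> of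
  them, and only the \<open>t\<close> values in the coset of 1 have cube roots at all.\<close>

lemma cube_roots_1: "cube_roots 1 = 3"
proof -
  have "(\<Sum>v\<in>{1..<p}. cube_roots v) = int t * (cube_roots 1 + cube_roots g + cube_roots (g ^ 2))"
    by (rule sum_units_cube_invariant) (simp_all add: cube_roots_mod cube_roots_cube generator_not_dvd)
  also have "\<dots> = int t * cube_roots 1"
    using cube_roots_generator[of 1] cube_roots_generator[of 2] by simp
  also have "(\<Sum>v\<in>{1..<p}. cube_roots v) =
      (\<Sum>x\<in>{1..<p}. \<Sum>v\<in>{1..<p}. of_bool (p dvd x ^ 3 - v))"
    unfolding cube_roots_def by (rule sum.swap)
  also have "\<dots> = (\<Sum>x\<in>{1..<p}. 1)"
  proof (rule sum.cong)
    fix x assume x: "x \<in> {1..<p}"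
    then have "\<not> p dvd x ^ 3" using not_dvd_unit prime_p prime_dvd_power by blast
    then have mem: "x ^ 3 mod p \<in> {1..<p}" by (rule mod_unit_mem)
    have "p dvd x ^ 3 - v \<longleftrightarrow> v = x ^ 3 mod p" if "v \<in> {1..<p}" for v
      using that by (auto simp: mod_eq_dvd_iff[symmetric])
    then have "(\<Sum>v\<in>{1..<p}. of_bool (p dvd x ^ 3 - v) :: int) =
        (\<Sum>v\<in>{1..<p}. if v = x ^ 3 mod p then 1 else 0)"
      by (intro sum.cong) auto
    then show "(\<Sum>v\<in>{1..<p}. of_bool (p dvd x ^ 3 - v) :: int) = 1" using mem by simp
  qed simp
  also have "\<dots> = int t * 3" by simp
  finally show ?thesis using t_pos by simp
qed

text \<open>For each of the \<open>3 * t\<close> choices of \<open>y\<close>, the possible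
  \<open>x\<close> are the cube roots of \<open>b * (- y) ^ 3\<close>, as many as those of
  \<open>b\<close>.\<close>

lemma representations_zero:
  "representations 1 b 0 = 3 * int t * cube_roots b"
proof -
  have "representations 1 b 0 = (\<Sum>y\<in>{1..<p}. cube_roots (b * (- y) ^ 3))"
    unfolding representations_def cube_roots_def by (subst sum.swap) simp
  also have "\<dots> = (\<Sum>y\<in>{1..<p}. cube_roots b)"
    by (intro sum.cong refl cube_roots_cube) (use not_dvd_unit in auto)
  finally show ?thesis by simp
qed

section \<open>Averaging and double counting\<close>

lemma sum_split_zero: "(\<Sum>v\<in>{0..<p}. f v) = f 0 + (\<Sum>v\<in>{1..<p}. f v)" for f :: "int \<Rightarrow> int"
proof -
  have "{0..<p} = insert 0 {1..<p}" using p_gt_1 by auto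
  then show ?thesis by simp
qed

lemma sum_residues_indicator:
  fixes f :: "int \<Rightarrow> int"
  assumes "\<And>v. f (v mod p) = f v"
  shows "(\<Sum>v\<in>{0..<p}. f v * of_bool (p dvd s + v)) = f (- s)"
proof -
  have "p dvd s + v \<longleftrightarrow> v = (- s) mod p" if "v \<in> {0..<p}" for v
    using that mod_eq_dvd_iff[of v p "- s"] by (auto simp: add.commute)
  then have "(\<Sum>v\<in>{0..<p}. f v * of_bool (p dvd s + v)) =
      (\<Sum>v\<in>{0..<p}. if v = (- s) mod p then f v else 0)"
    by (intro sum.cong) auto
  also have "\<dots> = f (- s)" using p_gt_1 assms by simp
  finally show ?thesis .
qed

lemma representations_mod: "representations a b (v mod p) = representations a b v"
  by (rule representations_cong) auto

text \<open>Each pair \<open>x\<close>, \<open>y\<close> solves the equation for exactly one residue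
  \<open>v\<close>, so the counts over all \<open>v\<close> add up to the square of
  \<open>3 * t\<close>. The nonzero \<open>v\<close> are grouped by coset.\<close>

lemma sum_representations:
  "representations a b 0 +
     int t * (representations a b 1 + representations a b g + representations a b (g ^ 2)) =
   9 * (int t)\<^sup>2"
proof -
  have "(\<Sum>v\<in>{1..<p}. representations a b v) =
      int t * (representations a b 1 + representations a b g + representations a b (g ^ 2))"
    by (rule sum_units_cube_invariant)
      (simp_all add: representations_mod representations_cube3 generator_not_dvd)
  moreover have "(\<Sum>v\<in>{0..<p}. representations a b v) =
      (\<Sum>x\<in>{1..<p}. \<Sum>y\<in>{1..<p}. \<Sum>v\<in>{0..<p}. of_bool (p dvd a * x ^ 3 + b * y ^ 3 + v))"
    unfolding representations_def
    by (rule trans[OF sum.swap], rule sum.cong, rule refl, rule sum.swap)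
  moreover have "\<dots> = (\<Sum>x\<in>{1..<p}. \<Sum>y\<in>{1..<p}. 1)"
    using sum_residues_indicator[of "\<lambda>_. 1"] by simp
  ultimately show ?thesis
    using sum_split_zero[of "representations a b"]
    by (simp add: power2_eq_square)
qed

text \<open>Both sides count the solutions of \<open>a x\<^sup>3 + b y\<^sup>3 + c z\<^sup>3 + d w\<^sup>3 = 0\<close> in units.\<close>

lemma sum_representations_exchange:
  "(\<Sum>v\<in>{0..<p}. representations a b v * representations c d v) =
   (\<Sum>v\<in>{0..<p}. representations a c v * representations b d v)"
proof -
  \<comment> \<open>Given \<open>z\<close> and \<open>w\<close>, the second factor admits only
    \<open>v = - (c * z ^ 3 + d * w ^ 3)\<close>. The sign disappears by
    \<open>representations_minus\<close>, and a count of quadruples is left.\<close>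
  have *: "(\<Sum>v\<in>{0..<p}. representations a b v * representations c d v) =
    (\<Sum>x\<in>{1..<p}. \<Sum>y\<in>{1..<p}. \<Sum>z\<in>{1..<p}. \<Sum>w\<in>{1..<p}.
      of_bool (p dvd a * x ^ 3 + b * y ^ 3 + c * z ^ 3 + d * w ^ 3))" for a b c d
  proof -
    have "(\<Sum>v\<in>{0..<p}. representations a b v * representations c d v) =
      (\<Sum>v\<in>{0..<p}. \<Sum>z\<in>{1..<p}. \<Sum>w\<in>{1..<p}.
         representations a b v * of_bool (p dvd (c * z ^ 3 + d * w ^ 3) + v))"
      by (simp only: representations_def[of c d] sum_distrib_left)
    also have "\<dots> = (\<Sum>z\<in>{1..<p}. \<Sum>w\<in>{1..<p}. \<Sum>v\<in>{0..<p}.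
         representations a b v * of_bool (p dvd (c * z ^ 3 + d * w ^ 3) + v))"
      by (rule trans[OF sum.swap], rule sum.cong, rule refl, rule sum.swap)
    also have "\<dots> = (\<Sum>z\<in>{1..<p}. \<Sum>w\<in>{1..<p}. representations a b (c * z ^ 3 + d * w ^ 3))"
      by (simp only: sum_residues_indicator[of "representations a b", OF representations_mod] representations_minus)
    also have "\<dots> = (\<Sum>z\<in>{1..<p}. \<Sum>w\<in>{1..<p}. \<Sum>x\<in>{1..<p}. \<Sum>y\<in>{1..<p}.
      of_bool (p dvd a * x ^ 3 + b * y ^ 3 + c * z ^ 3 + d * w ^ 3))"
      by (simp add: representations_def add.assoc)
    also have "\<dots> = (\<Sum>z\<in>{1..<p}. \<Sum>x\<in>{1..<p}. \<Sum>y\<in>{1..<p}. \<Sum>w\<in>{1..<p}.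
      of_bool (p dvd a * x ^ 3 + b * y ^ 3 + c * z ^ 3 + d * w ^ 3))"
      by (rule sum.cong, rule refl, rule trans[OF sum.swap], rule sum.cong, rule refl, rule sum.swap)
    also have "\<dots> = (\<Sum>x\<in>{1..<p}. \<Sum>y\<in>{1..<p}. \<Sum>z\<in>{1..<p}. \<Sum>w\<in>{1..<p}.
      of_bool (p dvd a * x ^ 3 + b * y ^ 3 + c * z ^ 3 + d * w ^ 3))"
      by (rule trans[OF sum.swap], rule sum.cong, rule refl, rule sum.swap)
    finally show ?thesis .
  qed
  \<comment> \<open>The quadruple count is unchanged when \<open>b\<close>, \<open>y\<close> trade
    places with \<open>c\<close>, \<open>z\<close>.\<close>
  show ?thesis unfolding *
    by (rule sum.cong, rule refl, rule trans[OF sum.swap]) (simp add: algebra_simps)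
qed

text \<open>
  Up to cubes and scaling, the four numbers below are the cyclotomic numbers of order three
  (times nine).  Besides the two linear relations, counting
  \<open>x\<^sup>3 + y\<^sup>3 + g z\<^sup>3 + g w\<^sup>3 = 0\<close> in two ways gives the quadratic one.
\<close>

lemma cyclotomic_relations:
  defines "\<alpha> \<equiv> representations 1 1 1" and "\<beta> \<equiv> representations 1 1 g"
    and "\<gamma> \<equiv> representations 1 1 (g ^ 2)" and "\<delta> \<equiv> representations 1 g (g ^ 2)"
  shows "\<alpha> + \<beta> + \<gamma> = 9 * int t - 9"
    and "\<beta> + \<gamma> + \<delta> = 9 * int t"
    and "81 * int t + \<alpha> * \<beta> + \<beta> * \<gamma> + \<gamma> * \<alpha> = \<beta>\<^sup>2 + \<gamma>\<^sup>2 + \<delta>\<^sup>2"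
proof -
  have g1: "representations 1 g 1 = \<beta>"
    unfolding \<beta>_def using representations_rotate representations_commute by metis
  \<comment> \<open>Multiplying by \<open>g ^ 2\<close> turns the coefficients 1, \<open>g\<close>,
    \<open>g\<close> into \<open>g ^ 2\<close>, \<open>g ^ 3\<close>, \<open>g ^ 3\<close>, and the
    cubes drop out.\<close>
  have gg: "representations 1 g g = \<gamma>"
  proof -
    have "representations 1 g g = representations (g ^ 2 * 1) (g ^ 2 * g) (g ^ 2 * g)"
      using representations_scale[of "g ^ 2"] not_dvd_generator_power by metis
    also have "\<dots> = representations (g ^ 2) (1 * g ^ 3) (1 * g ^ 3)"
      by (simp add: power2_eq_square power3_eq_cube mult.assoc)
    also have "\<dots> = representations (g ^ 2) 1 1"
      by (metis generator_not_dvd representations_cube1 representations_cube3 representations_commute)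
    finally show ?thesis unfolding \<gamma>_def using representations_rotate by metis
  qed
  have gg1: "representations g g 1 = \<gamma>"
    using gg representations_rotate by metis
  have ggv: "representations g g (g * v) = representations 1 1 v" for v
    using representations_scale[of g 1 1 v] generator_not_dvd by simp
  have ggg: "representations g g g = \<alpha>" "representations g g (g ^ 2) = \<beta>"
    using ggv[of 1] ggv[of g] by (simp_all add: \<alpha>_def \<beta>_def power2_eq_square)
  have gg0: "representations g g 0 = 9 * int t" "representations 1 1 0 = 9 * int t"
    using ggv[of 0] representations_zero[of 1] cube_roots_1 by simp_all
  have g0: "representations 1 g 0 = 0"
    using representations_zero[of g] cube_roots_generator[of 1] by simp
  note fold = \<alpha>_def[symmetric] \<beta>_def[symmetric] \<gamma>_def[symmetric] \<delta>_def[symmetric]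
  have t: "int t \<noteq> 0" using t_pos by simp
  have "int t * (\<alpha> + \<beta> + \<gamma>) = int t * (9 * int t - 9)"
    using sum_representations[of 1 1] unfolding gg0 fold
    by (simp add: power2_eq_square algebra_simps)
  with t show "\<alpha> + \<beta> + \<gamma> = 9 * int t - 9" by simp
  have "int t * (\<beta> + \<gamma> + \<delta>) = int t * (9 * int t)"
    using sum_representations[of 1 g] unfolding g0 g1 gg fold
    by (simp add: power2_eq_square algebra_simps)
  with t show "\<beta> + \<gamma> + \<delta> = 9 * int t" by simp
  have sum: "(\<Sum>v\<in>{0..<p}. representations a b v * representations c d v) =
      representations a b 0 * representations c d 0 +
      int t * (representations a b 1 * representations c d 1 +
        representations a b g * representations c d g +
        representations a b (g ^ 2) * representations c d (g ^ 2))" for a b c d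
    using sum_units_cube_invariant[of "\<lambda>v. representations a b v * representations c d v"]
    by (simp add: sum_split_zero representations_mod representations_cube3 generator_not_dvd)
  \<comment> \<open>On the left \<alpha>, \<beta>, \<gamma> are paired with \<gamma>, \<alpha>,
    \<beta>; on the right stand the squares of \<beta>, \<gamma>, \<delta>. The term at
    \<open>v = 0\<close> is the square of \<open>9 * int t\<close> on the left and 0 on the
    right.\<close>
  have "int t * (81 * int t + \<alpha> * \<beta> + \<beta> * \<gamma> + \<gamma> * \<alpha>) = int t * (\<beta>\<^sup>2 + \<gamma>\<^sup>2 + \<delta>\<^sup>2)"
    using sum_representations_exchange[of 1 1 g g]
    unfolding sum gg0 g0 g1 gg gg1 ggg fold
    by (simp add: power2_eq_square algebra_simps)
  with t show "81 * int t + \<alpha> * \<beta> + \<beta> * \<gamma> + \<gamma> * \<alpha> = \<beta>\<^sup>2 + \<gamma>\<^sup>2 + \<delta>\<^sup>2" by simp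
qed

section \<open>Positivity of the cyclotomic numbers\<close>

lemma cyclotomic_pos:
  assumes "t \<ge> 6"
  shows "representations 1 1 1 > 0" "representations 1 1 g > 0"
    "representations 1 1 (g ^ 2) > 0" "representations 1 g (g ^ 2) > 0"
proof -
  define \<alpha> \<beta> \<gamma> \<delta> where d: "\<alpha> = representations 1 1 1" "\<beta> = representations 1 1 g"
    "\<gamma> = representations 1 1 (g ^ 2)" "\<delta> = representations 1 g (g ^ 2)"
  define u where "u = int t"
  note rel = cyclotomic_relations[folded d u_def]
  have nonneg: "\<alpha> \<ge> 0" "\<beta> \<ge> 0" "\<gamma> \<ge> 0" "\<delta> \<ge> 0"
    unfolding d by (rule representations_nonneg)+
  have u: "u \<ge> 6" using assms by (simp add: u_def)
  have \<delta>: "\<delta> = \<alpha> + 9" using rel by simp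
  \<comment> \<open>If \<alpha> vanished, \<beta> and \<gamma> would have sum
    \<open>9 * (u - 1)\<close> and product \<open>27 * (u - 1) * (u - 2)\<close>. The square of the
    sum is at least four times the product, which forces \<open>u \<le> 5\<close>.\<close>
  have 1: "\<alpha> \<noteq> 0"
  proof
    assume "\<alpha> = 0"
    with rel(1) \<delta> have \<gamma>: "\<gamma> = 9 * (u - 1) - \<beta>" and "\<delta> = 9" by simp_all
    have "3 * (\<beta> * \<gamma>) = 81 * (u - 1) * (u - 2)"
      using rel(3) unfolding \<open>\<alpha> = 0\<close> \<open>\<delta> = 9\<close> \<gamma> by (simp add: power2_eq_square algebra_simps)
    moreover have "4 * (\<beta> * \<gamma>) \<le> (\<beta> + \<gamma>)\<^sup>2"
      using zero_le_power2[of "\<beta> - \<gamma>"] by (simp add: power2_eq_square algebra_simps)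
    moreover have "(\<beta> + \<gamma>)\<^sup>2 = 81 * (u - 1) * (u - 1)"
      by (simp add: \<gamma> power2_eq_square algebra_simps)
    ultimately have "81 * ((u - 1) * (u - 5)) \<le> 0"
      by (simp add: algebra_simps)
    moreover have "(u - 1) * (u - 5) > 0" using u by simp
    ultimately show False by simp
  qed
  \<comment> \<open>The relations are symmetric in \<beta> and \<gamma>: \<open>x\<close> is the
    vanishing one, \<open>y\<close> the other. Eliminating \<alpha> leaves a quadratic equation for
    \<open>y\<close> with discriminant \<open>- 9 * (27 * u * u - 54 * u - 9)\<close>, negative for
    \<open>u \<ge> 6\<close>.\<close>
  have 2: False if "x = 0" "\<alpha> + x + y = 9 * u - 9"
    "81 * u + \<alpha> * x + x * y + y * \<alpha> = x\<^sup>2 + y\<^sup>2 + \<delta>\<^sup>2" for x y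
  proof -
    have \<alpha>: "\<alpha> = 9 * u - 9 - y" using that by simp
    have "3 * y * y - 9 * (3 * u - 1) * y + 81 * u * (u - 1) = 0"
      using that(3) unfolding \<delta> \<alpha> \<open>x = 0\<close> by (simp add: power2_eq_square algebra_simps)
    moreover have "(2 * y - 3 * (3 * u - 1))\<^sup>2 \<ge> 0" by simp
    ultimately have "27 * (u * u) \<le> 54 * u + 9"
      by (simp add: power2_eq_square algebra_simps)
    moreover have "u * u \<ge> 6 * u" using u by simp
    ultimately show False using u by simp
  qed
  have 3: "\<beta> \<noteq> 0" "\<gamma> \<noteq> 0"
    using 2[of \<beta> \<gamma>] 2[of \<gamma> \<beta>] rel by (auto simp: algebra_simps)
  show "representations 1 1 1 > 0" "representations 1 1 g > 0"
    "representations 1 1 (g ^ 2) > 0" "representations 1 g (g ^ 2) > 0"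
    using 1 3 nonneg \<delta> unfolding d by simp_all
qed

text \<open>In terms of discrete logarithms, the count depends only on the exponents modulo 3, not
  on their order, and not on a simultaneous shift. This leaves the triples (0,0,0), (0,0,1), (0,0,2)
  and (0,1,2), which are the four cyclotomic numbers.\<close>

lemma representations_pos:
  assumes "t \<ge> 6" and "\<not> p dvd a" "\<not> p dvd b" "\<not> p dvd c"
  shows "representations a b c > 0"
proof -
  define R where "R i j k = representations (g ^ i) (g ^ j) (g ^ k)" for i j k
  have swap: "R i j k = R j i k" "R i j k = R k j i" for i j k
    unfolding R_def using representations_commute representations_rotate by metis+
  have "R (i + 3) j k = R i j k" for i j k
    using representations_cube1[OF generator_not_dvd] by (simp add: R_def power_add)
  then have mod1: "R i j k = R (i mod 3) j k" for i j k
  proof (induction i rule: less_induct)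
    case (less i)
    show ?case
    proof (cases "i < 3")
      case False
      then have "R i j k = R (i - 3) j k" using less.prems[of "i - 3" j k] by simp
      then show ?thesis using less.IH[of "i - 3"] less.prems False by (simp add: le_mod_geq)
    qed simp
  qed
  have red: "R i j k = R (i mod 3) (j mod 3) (k mod 3)" for i j k
    using mod1 swap by metis
  have shift: "R (Suc i) (Suc j) (Suc k) = R i j k" for i j k
    using representations_scale[OF generator_not_dvd] by (simp add: R_def)
  have base: "R 0 0 0 > 0" "R 0 0 1 > 0" "R 0 0 2 > 0" "R 0 1 2 > 0"
    using cyclotomic_pos[OF assms(1)] by (simp_all add: R_def)
  have pos: "R i j k > 0" if "i < 3" "j < 3" "k < 3" for i j k
  proof -
    \<comment> \<open>A shift by two, respectively by one, turns the repeated exponent into 3, which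
      counts as 0.\<close>
    have s: "R 1 1 k = R 0 0 ((k + 2) mod 3)" "R 2 2 k = R 0 0 ((k + 1) mod 3)" for k
    proof -
      have "R 1 1 k = R 3 3 (k + 2)"
        using shift[of 1 1 k] shift[of 2 2 "Suc k"] by (simp add: numeral_eq_Suc)
      then show "R 1 1 k = R 0 0 ((k + 2) mod 3)" using red[of 3 3 "k + 2"] by simp
      have "R 2 2 k = R 3 3 (k + 1)"
        using shift[of 2 2 k] by (simp add: numeral_eq_Suc)
      then show "R 2 2 k = R 0 0 ((k + 1) mod 3)" using red[of 3 3 "k + 1"] by simp
    qed
    have eq: "R i i k > 0" if "i < 3" "k < 3" for i k
    proof -
      have "R 0 0 k > 0" if "k < 3" for k
      proof -
        have "k = 0 \<or> k = 1 \<or> k = 2" using that by auto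
        then show ?thesis using base by (elim disjE) simp_all
      qed
      moreover have "i = 0 \<or> i = 1 \<or> i = 2" using that(1) by auto
      ultimately show ?thesis using s that(2) by auto
    qed
    have perms: "R 0 2 1 > 0" "R 1 0 2 > 0" "R 1 2 0 > 0" "R 2 0 1 > 0" "R 2 1 0 > 0"
      using base(4) swap by metis+
    have eqs: "R i k i > 0" "R k i i > 0" if "i < 3" "k < 3" for i k
      using eq[OF that] swap by metis+
    have "i = 0 \<or> i = 1 \<or> i = 2" "j = 0 \<or> j = 1 \<or> j = 2" "k = 0 \<or> k = 1 \<or> k = 2"
      using that by auto
    then show ?thesis
      using base(4) perms by (elim disjE) (simp_all only: eq eqs)
  qed
  obtain i j k where "[a = g ^ i] (mod p)" "[b = g ^ j] (mod p)" "[c = g ^ k] (mod p)"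
    using generator_log assms(2-4) by metis
  then have "representations a b c = R i j k"
    unfolding R_def by (rule representations_cong)
  then show ?thesis
    using red[of i j k] pos[of "i mod 3" "j mod 3" "k mod 3"] by simp
qed

section \<open>Representing residues by few cubes\<close>

lemma two_cubes_represent:
  assumes "t \<ge> 6" and "\<not> p dvd a" "\<not> p dvd b" "\<not> p dvd c"
  obtains x y where "\<not> p dvd x" "\<not> p dvd y" "[a * x ^ 3 + b * y ^ 3 = c] (mod p)"
proof -
  have "representations a b (- c) > 0"
    using representations_pos assms by simp
  then have "\<exists>x\<in>{1..<p}. \<exists>y\<in>{1..<p}. p dvd a * x ^ 3 + b * y ^ 3 + - c"
    by (rule contrapos_pp) (simp add: representations_def)
  then obtain x y where "x \<in> {1..<p}" "y \<in> {1..<p}" "p dvd a * x ^ 3 + b * y ^ 3 + - c"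
    by blast
  then show thesis using that[of x y] not_dvd_unit by (auto simp: cong_iff_dvd_diff)
qed

end

lemma cubic_residues_exists:
  fixes p :: int
  assumes "prime p" and "p = 3 * int t + 1"
  obtains g where "cubic_residues p g t"
proof -
  define q where "q = nat p"
  have q: "prime q" "p = int q" "q = 3 * t + 1"
    using assms prime_nat_iff_prime by (auto simp: q_def)
  then obtain g where "residue_primroot q g"
    using prime_primitive_root_exists[of q] prime_gt_1_nat by blast
  then have bij: "bij_betw (\<lambda>k. g ^ k mod q) {..<3 * t} {1..<q}"
    using residue_primroot_is_generator[of q g] q totient_prime[of q] totatives_prime[of q]
      prime_gt_1_nat[of q]
    by (simp add: atLeastSucLessThan_greaterThanLessThan)
  have "bij_betw int {1..<q} {1..<p}"
    by (rule bij_betwI[of _ _ _ nat]) (auto simp: q(2))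
  with bij have "bij_betw (int \<circ> (\<lambda>k. g ^ k mod q)) {..<3 * t} {1..<p}"
    by (rule bij_betw_trans)
  then have "bij_betw (\<lambda>k. int g ^ k mod p) {..<3 * t} {1..<p}"
    by (simp add: comp_def q(2) zmod_int)
  with assms show thesis using that by (simp add: cubic_residues_def)
qed

text \<open>Two cubes are known to reach the nonzero residues. So \<open>z\<close> is taken as 1 or
  -1 in such a way that \<open>w - c * z ^ 3\<close> is nonzero; if both choices failed,
  \<open>p\<close> would divide \<open>2 * c\<close>.\<close>

lemma three_cubes_represent:
  fixes p :: int
  assumes "prime p" "p mod 3 = 1" "p \<ge> 19" and "\<not> p dvd a" "\<not> p dvd b" "\<not> p dvd c"
  obtains x y z where "\<not> p dvd x" "\<not> p dvd y" "\<not> p dvd z"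
    "[a * x ^ 3 + b * y ^ 3 + c * z ^ 3 = w] (mod p)"
proof -
  define t where "t = nat (p div 3)"
  have p: "p = 3 * int t + 1" and t: "t \<ge> 6"
    using assms(2,3) by (auto simp: t_def; presburger)+
  obtain g where "cubic_residues p g t"
    using cubic_residues_exists[OF assms(1) p] by blast
  then interpret cubic_residues p g t .
  have m1: "\<not> p dvd 1" "\<not> p dvd - 1" using p_gt_1 by auto
  obtain z where z: "\<not> p dvd z" "\<not> p dvd w - c * z ^ 3"
  proof (cases "p dvd w - c")
    case True
    have "\<not> p dvd w + c"
    proof
      assume "p dvd w + c"
      then have "p dvd (w + c) - (w - c)" using True dvd_diff by blast
      then have "p dvd 2 * c" by simp
      then have "p dvd 2" using assms by (simp add: prime_dvd_mult_iff)
      then show False using zdvd_imp_le[of p 2] assms(3) by simp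
    qed
    then show thesis using that[of "-1"] m1 by simp
  next
    case False
    then show thesis using that[of 1] m1 by simp
  qed
  obtain x y where "\<not> p dvd x" "\<not> p dvd y" "[a * x ^ 3 + b * y ^ 3 = w - c * z ^ 3] (mod p)"
    using two_cubes_represent[OF t assms(4,5) z(2)] by blast
  then show thesis using that[of x y z] z by (simp add: cong_iff_dvd_diff algebra_simps)
qed

lemma non_cube_exists:
  fixes p :: int
  assumes "prime p" "p mod 3 = 1"
  obtains c where "\<not> p dvd c" "\<And>x. \<not> [x ^ 3 = c] (mod p)"
proof -
  define t where "t = nat (p div 3)"
  have p: "p = 3 * int t + 1"
    using assms(2) prime_gt_0_int[OF assms(1)] by (auto simp: t_def; presburger)+
  obtain g where "cubic_residues p g t"
    using cubic_residues_exists[OF assms(1) p] by blast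
  then interpret cubic_residues p g t .
  show thesis using that[of g] generator_not_dvd generator_power_not_cube[of 1] by simp
qed

text \<open>Cubing is inverted by the exponent \<open>e = (2 * p - 1) div 3\<close>: here
  \<open>3 * e = 2 * (p - 1) + 1\<close>, and Fermat's theorem applies.\<close>

lemma all_units_cubes:
  fixes p :: int
  assumes "prime p" "p mod 3 = 2" "\<not> p dvd a"
  obtains x where "\<not> p dvd x" "[x ^ 3 = a] (mod p)"
proof -
  define e where "e = nat ((2 * p - 1) div 3)"
  have p: "p > 1" using assms prime_gt_1_int by blast
  have e: "3 * e = Suc (2 * nat (p - 1))"
  proof -
    have "3 * ((2 * p - 1) div 3) = 2 * (p - 1) + 1" using assms(2) by presburger
    moreover have "int e = (2 * p - 1) div 3" using p by (simp add: e_def)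
    ultimately have "int (3 * e) = int (Suc (2 * nat (p - 1)))" using p by simp
    then show ?thesis by (simp only: of_nat_eq_iff)
  qed
  have "[int (nat (a mod p) ^ (nat p - 1)) = int 1] (mod int (nat p))"
    unfolding cong_int_iff
  proof (rule fermat_theorem)
    show "prime (nat p)" using assms(1) by simp
    show "\<not> nat p dvd nat (a mod p)" using assms(3) p
      by (simp add: nat_dvd_iff dvd_mod_iff)
  qed
  then have "[(a mod p) ^ nat (p - 1) = 1] (mod p)"
    using p by (simp add: nat_diff_distrib)
  then have fermat: "[a ^ nat (p - 1) = 1] (mod p)"
    by (simp add: cong_def power_mod)
  have "(a ^ e) ^ 3 = (a ^ nat (p - 1)) ^ 2 * a"
  proof -
    have "(a ^ e) ^ 3 = a ^ (3 * e)" by (simp add: mult.commute flip: power_mult)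
    also have "\<dots> = (a ^ nat (p - 1)) ^ 2 * a"
      unfolding e by (simp add: mult.commute flip: power_mult)
    finally show ?thesis .
  qed
  moreover have "[(a ^ nat (p - 1)) ^ 2 * a = 1 ^ 2 * a] (mod p)"
    by (intro cong_mult cong_pow fermat cong_refl)
  ultimately have "[(a ^ e) ^ 3 = a] (mod p)" by simp
  moreover have "\<not> p dvd a ^ e" using assms prime_dvd_power by blast
  ultimately show thesis using that by blast
qed

text \<open>As for three cubes, \<open>y = 1\<close> or \<open>y = -1\<close> leaves a nonzero
  remainder, which a suitable \<open>x\<close> supplies because every unit is a cube.\<close>

lemma two_cubes_represent_2_mod_3:
  fixes p :: int
  assumes "prime p" "p mod 3 = 2" "p \<ge> 5" and "\<not> p dvd a" "\<not> p dvd b"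
  obtains x y where "\<not> p dvd x" "\<not> p dvd y" "[a * x ^ 3 + b * y ^ 3 = w] (mod p)"
proof -
  have m1: "\<not> p dvd 1" "\<not> p dvd - 1" using assms(3) by auto
  obtain y where y: "\<not> p dvd y" "\<not> p dvd w - b * y ^ 3"
  proof (cases "p dvd w - b")
    case True
    have "\<not> p dvd w + b"
    proof
      assume "p dvd w + b"
      then have "p dvd (w + b) - (w - b)" using True dvd_diff by blast
      then have "p dvd 2 * b" by simp
      then have "p dvd 2" using assms by (simp add: prime_dvd_mult_iff)
      then show False using zdvd_imp_le[of p 2] assms(3) by simp
    qed
    then show thesis using that[of "-1"] m1 by simp
  next
    case False
    then show thesis using that[of 1] m1 by simp
  qed
  have "coprime a p" using prime_imp_coprime[OF assms(1,4)] by (simp add: coprime_commute)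
  then obtain a' where a': "[a * a' = 1] (mod p)" using cong_solve_coprime_int by blast
  have "\<not> p dvd a'"
    using a' m1 cong_dvd_iff[OF a'] by auto
  then have "\<not> p dvd a' * (w - b * y ^ 3)" using y assms by (simp add: prime_dvd_mult_iff)
  then obtain x where x: "\<not> p dvd x" "[x ^ 3 = a' * (w - b * y ^ 3)] (mod p)"
    using all_units_cubes assms by blast
  have "[a * x ^ 3 = a * (a' * (w - b * y ^ 3))] (mod p)"
    using x by (intro cong_mult cong_refl)
  also have "a * (a' * (w - b * y ^ 3)) = (a * a') * (w - b * y ^ 3)" by simp
  also have "[\<dots> = 1 * (w - b * y ^ 3)] (mod p)"
    by (intro cong_mult a' cong_refl)
  finally show thesis using that[of x y] x y by (simp add: cong_iff_dvd_diff algebra_simps)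
qed

section \<open>Zero sums weighted by cubes of units\<close>

definition prime_weight :: "int \<Rightarrow> nat" where
  "prime_weight p = (if p mod 3 = 1 then 2 else 1)"

text \<open>For admissible \<open>m\<close> this is one less than the Davenport constant, by
  \<open>davenport_unit_cubes\<close>.\<close>

definition total_weight :: "int \<Rightarrow> nat" where
  "total_weight m = (\<Sum>p\<in>#prime_factorization m. prime_weight p)"

text \<open>The primes that the hypotheses of the theorem leave over: 19 is the first prime
  congruent to 1 modulo 3 after 7 and 13, and the bound 5 excludes 2.\<close>

definition admissible_prime :: "int \<Rightarrow> bool" where
  "admissible_prime p \<longleftrightarrow> prime p \<and> (p mod 3 = 1 \<and> p \<ge> 19 \<or> p mod 3 = 2 \<and> p \<ge> 5)"

definition admissible :: "int \<Rightarrow> bool" where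
  "admissible m \<longleftrightarrow> m > 0 \<and> squarefree m \<and> (\<forall>p. prime p \<longrightarrow> p dvd m \<longrightarrow> admissible_prime p)"

lemma prime_weight_pos: "prime_weight p > 0"
  by (simp add: prime_weight_def)

lemma admissible_pos: "admissible m \<Longrightarrow> m > 0"
  by (simp add: admissible_def)

lemma admissible_primeD: "admissible_prime p \<Longrightarrow> prime p"
  by (simp add: admissible_prime_def)

lemma total_weight_1 [simp]: "total_weight 1 = 0"
  by (simp add: total_weight_def)

lemma total_weight_mult: "a \<noteq> 0 \<Longrightarrow> b \<noteq> 0 \<Longrightarrow> total_weight (a * b) = total_weight a + total_weight b"
  by (simp add: total_weight_def prime_factorization_mult)

lemma total_weight_prime: "prime p \<Longrightarrow> total_weight p = prime_weight p"
  by (simp add: total_weight_def prime_factorization_prime)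

lemma admissible_prime_cofactor:
  assumes "admissible m" "prime p" "p dvd m"
  shows "m = p * (m div p)" "admissible_prime p" "admissible (m div p)" "coprime p (m div p)"
    "m div p < m" "total_weight m = prime_weight p + total_weight (m div p)"
proof -
  have p: "p > 1" using assms(2) prime_gt_1_int by blast
  show m: "m = p * (m div p)" using assms(3) by simp
  show ap: "admissible_prime p" using assms by (simp add: admissible_def)
  have pos: "m div p > 0"
    using admissible_pos[OF assms(1)] m p by (metis less_trans zero_less_mult_pos zero_less_one)
  have "squarefree m" using assms(1) by (simp add: admissible_def)
  then have sq: "squarefree (m div p)" using m by (metis dvd_triv_right squarefree_mono)
  show "coprime p (m div p)"
  proof (rule prime_imp_coprime[OF assms(2)])
    show "\<not> p dvd m div p"
    proof
      assume "p dvd m div p"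
      then have "p * p dvd m" using m by (metis mult_dvd_mono dvd_refl)
      then have "p dvd 1" using \<open>squarefree m\<close> by (simp add: squarefree_def power2_eq_square)
      then show False using assms(2) not_prime_unit by blast
    qed
  qed
  show "admissible (m div p)"
    using assms(1) m pos sq unfolding admissible_def by (metis dvd_mult)
  show "m div p < m" using int_div_less_self p admissible_pos[OF assms(1)] by blast
  show "total_weight m = prime_weight p + total_weight (m div p)"
    using total_weight_mult[of p "m div p"] total_weight_prime[OF assms(2)] pos p assms(3)
    by (simp del: mult_cancel_left)
qed

lemma admissible_induct [consumes 1, case_names one mult]:
  assumes "admissible m" and "P 1"
    and step: "\<And>p m. admissible_prime p \<Longrightarrow> admissible m \<Longrightarrow> coprime p m \<Longrightarrow> P m \<Longrightarrow> P (p * m)"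
  shows "P m"
  using assms(1)
proof (induction "nat m" arbitrary: m rule: less_induct)
  case less
  show ?case
  proof (cases "m = 1")
    case False
    then obtain p where p: "prime p" "p dvd m"
      using less.prems prime_divisor_exists[of m] by (auto simp: admissible_def)
    note c = admissible_prime_cofactor[OF less.prems p]
    have "P (m div p)"
      using less.hyps[of "m div p"] c admissible_pos less.prems by (simp add: nat_less_eq_zless)
    then show ?thesis using step[OF c(2,3,4)] c(1) by simp
  qed (use assms(2) in simp)
qed

section \<open>Zero sums of indexed families\<close>

definition cube_zero_sum :: "int \<Rightarrow> 'a set \<Rightarrow> ('a \<Rightarrow> int) \<Rightarrow> bool" where
  "cube_zero_sum m I x \<longleftrightarrow>
     (\<exists>b. (\<forall>i\<in>I. coprime (b i) m) \<and> m dvd (\<Sum>i\<in>I. b i ^ 3 * x i))"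

text \<open>Families over index sets take the place of multisets: sub-multisets become subsets of
  \<open>J\<close>, equal terms stay distinguishable, and each weight is attached to an
  index.\<close>

definition has_cube_zero_sum :: "int \<Rightarrow> 'a set \<Rightarrow> ('a \<Rightarrow> int) \<Rightarrow> bool" where
  "has_cube_zero_sum m J x \<longleftrightarrow> (\<exists>I\<subseteq>J. I \<noteq> {} \<and> cube_zero_sum m I x)"

lemma cube_zero_sum_cong:
  assumes "I = I'" "\<And>i. i \<in> I' \<Longrightarrow> [x i = x' i] (mod m)"
  shows "cube_zero_sum m I x \<longleftrightarrow> cube_zero_sum m I' x'"
proof -
  have "m dvd (\<Sum>i\<in>I. b i ^ 3 * x i) \<longleftrightarrow> m dvd (\<Sum>i\<in>I'. b i ^ 3 * x' i)" for b
    unfolding assms(1) by (intro cong_dvd_iff cong_sum cong_mult cong_refl assms(2))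
  then show ?thesis by (simp add: cube_zero_sum_def assms(1))
qed

lemma has_cube_zero_sum_cong:
  assumes "J = J'" "\<And>i. i \<in> J' \<Longrightarrow> [x i = x' i] (mod m)"
  shows "has_cube_zero_sum m J x \<longleftrightarrow> has_cube_zero_sum m J' x'"
proof -
  have "cube_zero_sum m I x \<longleftrightarrow> cube_zero_sum m I x'" if "I \<subseteq> J'" for I
    using that assms(2) by (intro cube_zero_sum_cong) auto
  then show ?thesis unfolding has_cube_zero_sum_def assms(1) by auto
qed

lemma has_cube_zero_sum_mono:
  "has_cube_zero_sum m J x \<Longrightarrow> J \<subseteq> J' \<Longrightarrow> has_cube_zero_sum m J' x"
  unfolding has_cube_zero_sum_def by blast

lemma cube_zero_sum_image:
  assumes "inj_on f I"
  shows "cube_zero_sum m (f ` I) x \<longleftrightarrow> cube_zero_sum m I (\<lambda>i. x (f i))"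
proof
  assume "cube_zero_sum m (f ` I) x"
  then obtain b where "\<forall>i\<in>f ` I. coprime (b i) m" "m dvd (\<Sum>i\<in>f ` I. b i ^ 3 * x i)"
    by (auto simp: cube_zero_sum_def)
  then show "cube_zero_sum m I (\<lambda>i. x (f i))"
    unfolding cube_zero_sum_def
    by (intro exI[of _ "\<lambda>i. b (f i)"]) (simp add: sum.reindex[OF assms])
next
  assume "cube_zero_sum m I (\<lambda>i. x (f i))"
  then obtain b where b: "\<forall>i\<in>I. coprime (b i) m" "m dvd (\<Sum>i\<in>I. b i ^ 3 * x (f i))"
    by (auto simp: cube_zero_sum_def)
  have "(\<Sum>i\<in>I. b (the_inv_into I f (f i)) ^ 3 * x (f i)) = (\<Sum>i\<in>I. b i ^ 3 * x (f i))"
    by (intro sum.cong refl) (simp add: the_inv_into_f_f[OF assms])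
  then show "cube_zero_sum m (f ` I) x"
    unfolding cube_zero_sum_def using b
    by (intro exI[of _ "\<lambda>j. b (the_inv_into I f j)"])
      (auto simp: sum.reindex[OF assms] the_inv_into_f_f[OF assms])
qed

lemma unit_chinese_remainder:
  fixes m1 m2 :: int
  assumes "coprime m1 m2" "\<forall>i\<in>I. coprime (b1 i) m1" "\<forall>i\<in>I. coprime (b2 i) m2"
  shows "\<exists>b. \<forall>i\<in>I. coprime (b i) (m1 * m2) \<and> [b i = b1 i] (mod m1) \<and> [b i = b2 i] (mod m2)"
proof -
  have "\<exists>c. [c = b1 i] (mod m1) \<and> [c = b2 i] (mod m2)" for i
    using binary_chinese_remainder_int[OF assms(1)] by blast
  then obtain b where b: "\<And>i. [b i = b1 i] (mod m1) \<and> [b i = b2 i] (mod m2)" by metis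
  then have "coprime (b i) (m1 * m2)" if "i \<in> I" for i
    using assms(2,3) that cong_imp_coprime cong_sym coprime_mult_right_iff by metis
  with b show ?thesis by blast
qed

text \<open>The weights for the two moduli are glued term by term with the Chinese remainder
  theorem.\<close>

lemma cube_zero_sum_mult:
  assumes "coprime m1 m2" "cube_zero_sum m1 I x" "cube_zero_sum m2 I x"
  shows "cube_zero_sum (m1 * m2) I x"
proof -
  obtain b1 b2 where
    b1: "\<forall>i\<in>I. coprime (b1 i) m1" "m1 dvd (\<Sum>i\<in>I. b1 i ^ 3 * x i)" and
    b2: "\<forall>i\<in>I. coprime (b2 i) m2" "m2 dvd (\<Sum>i\<in>I. b2 i ^ 3 * x i)"
    using assms(2,3) by (auto simp: cube_zero_sum_def)
  obtain b where b: "\<And>i. i \<in> I \<Longrightarrow> coprime (b i) (m1 * m2)"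
    "\<And>i. i \<in> I \<Longrightarrow> [b i = b1 i] (mod m1)" "\<And>i. i \<in> I \<Longrightarrow> [b i = b2 i] (mod m2)"
    using unit_chinese_remainder[OF assms(1) b1(1) b2(1)] by blast
  have "m1 dvd (\<Sum>i\<in>I. b i ^ 3 * x i) \<longleftrightarrow> m1 dvd (\<Sum>i\<in>I. b1 i ^ 3 * x i)"
    by (intro cong_dvd_iff cong_sum cong_mult cong_pow cong_refl b)
  moreover have "m2 dvd (\<Sum>i\<in>I. b i ^ 3 * x i) \<longleftrightarrow> m2 dvd (\<Sum>i\<in>I. b2 i ^ 3 * x i)"
    by (intro cong_dvd_iff cong_sum cong_mult cong_pow cong_refl b)
  ultimately have "m1 * m2 dvd (\<Sum>i\<in>I. b i ^ 3 * x i)"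
    using b1 b2 assms(1) divides_mult by blast
  with b show ?thesis by (auto simp: cube_zero_sum_def)
qed

lemma cube_zero_sum_scaled:
  assumes "coprime p m" "p \<noteq> 0" "\<And>i. i \<in> I \<Longrightarrow> p dvd x i"
  shows "cube_zero_sum (p * m) I x \<longleftrightarrow> cube_zero_sum m I (\<lambda>i. x i div p)"
proof -
  have eq: "(\<Sum>i\<in>I. b i ^ 3 * x i) = p * (\<Sum>i\<in>I. b i ^ 3 * (x i div p))" for b
    unfolding sum_distrib_left using assms(3) by (intro sum.cong) auto
  show ?thesis
  proof
    assume "cube_zero_sum (p * m) I x"
    then show "cube_zero_sum m I (\<lambda>i. x i div p)"
      using assms(2) by (auto simp: cube_zero_sum_def eq)
  next
    assume "cube_zero_sum m I (\<lambda>i. x i div p)"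
    then have "cube_zero_sum m I x"
      unfolding cube_zero_sum_def eq by (meson dvd_mult)
    \<comment> \<open>The weights found modulo \<open>m\<close> may be divisible by
      \<open>p\<close>. Modulo \<open>p\<close> the sum vanishes for any weights, so weight 1 there
      can be glued to them.\<close>
    moreover have "cube_zero_sum p I x"
      unfolding cube_zero_sum_def eq by (intro exI[of _ "\<lambda>_. 1"]) simp
    ultimately show "cube_zero_sum (p * m) I x"
      using cube_zero_sum_mult[OF assms(1)] by blast
  qed
qed

lemma has_cube_zero_sum_scaled:
  assumes "coprime p m" "p \<noteq> 0" "\<And>i. i \<in> J \<Longrightarrow> p dvd x i"
  shows "has_cube_zero_sum (p * m) J x \<longleftrightarrow> has_cube_zero_sum m J (\<lambda>i. x i div p)"
proof -
  have "cube_zero_sum (p * m) I x \<longleftrightarrow> cube_zero_sum m I (\<lambda>i. x i div p)" if "I \<subseteq> J" for I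
    using that assms(3) by (intro cube_zero_sum_scaled assms(1,2)) auto
  then show ?thesis unfolding has_cube_zero_sum_def by auto
qed

section \<open>Zero sums in long families\<close>

lemma cube_zero_sum_prime:
  assumes p: "admissible_prime p" and "finite J"
    and card: "prime_weight p < card {i\<in>J. \<not> p dvd x i}"
  shows "cube_zero_sum p J x"
proof -
  \<comment> \<open>All terms outside \<open>K\<close> receive weight 1, and the weights on
    \<open>K\<close> only have to produce the negative of their sum. Below, \<open>K\<close>
    consists of \<open>prime_weight p + 1\<close> terms prime to \<open>p\<close>.\<close>
  have solve: "cube_zero_sum p J x"
    if K: "K \<subseteq> J" and b: "\<And>i. i \<in> K \<Longrightarrow> \<not> p dvd b i"
      and eq: "[(\<Sum>i\<in>K. b i ^ 3 * x i) = - (\<Sum>i\<in>J - K. x i)] (mod p)" for K b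
  proof -
    define b' where "b' i = (if i \<in> K then b i else 1)" for i
    have "(\<Sum>i\<in>J. b' i ^ 3 * x i) = (\<Sum>i\<in>J - K. b' i ^ 3 * x i) + (\<Sum>i\<in>K. b' i ^ 3 * x i)"
      using sum.subset_diff[OF K \<open>finite J\<close>] .
    also have "\<dots> = (\<Sum>i\<in>K. b i ^ 3 * x i) + (\<Sum>i\<in>J - K. x i)"
      by (simp add: b'_def add.commute)
    also have "p dvd \<dots>" using eq by (simp add: cong_iff_dvd_diff)
    finally have "p dvd (\<Sum>i\<in>J. b' i ^ 3 * x i)" .
    moreover have "coprime (b' i) p" for i
      using b[of i] prime_imp_coprime[OF admissible_primeD[OF p], of "b i"]
      by (simp add: b'_def coprime_commute)
    ultimately show ?thesis by (auto simp: cube_zero_sum_def)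
  qed
  consider "p mod 3 = 1" "p \<ge> 19" "prime p" | "p mod 3 = 2" "p \<ge> 5" "prime p"
    using p by (auto simp: admissible_prime_def)
  then show ?thesis
  proof cases
    case 1
    then have "Suc (Suc (Suc 0)) \<le> card {i\<in>J. \<not> p dvd x i}"
      using card by (simp add: prime_weight_def)
    then obtain K where K: "K \<subseteq> {i\<in>J. \<not> p dvd x i}" "card K = 3"
      using obtain_subset_with_card_n by (metis numeral_3_eq_3)
    then obtain i j k where ijk: "K = {i, j, k}" "i \<noteq> j" "i \<noteq> k" "j \<noteq> k"
      using card_3_iff[of K] by auto
    have nd: "\<not> p dvd x i" "\<not> p dvd x j" "\<not> p dvd x k" using K ijk by auto
    obtain u v w where uvw: "\<not> p dvd u" "\<not> p dvd v" "\<not> p dvd w"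
      "[x i * u ^ 3 + x j * v ^ 3 + x k * w ^ 3 = - (\<Sum>i\<in>J - K. x i)] (mod p)"
      using three_cubes_represent[OF 1(3,1,2) nd, of "- (\<Sum>i\<in>J - K. x i)"] by blast
    show ?thesis
    proof (rule solve[of K "(\<lambda>_. w)(i := u, j := v)"])
      show "[(\<Sum>l\<in>K. (((\<lambda>_. w)(i := u, j := v)) l) ^ 3 * x l) = - sum x (J - K)] (mod p)"
        using uvw(4) ijk by (simp add: mult.commute add.assoc)
    qed (use K uvw in auto)
  next
    case 2
    then have "Suc (Suc 0) \<le> card {i\<in>J. \<not> p dvd x i}"
      using card by (simp add: prime_weight_def)
    then obtain K where K: "K \<subseteq> {i\<in>J. \<not> p dvd x i}" "card K = 2"
      using obtain_subset_with_card_n by (metis numeral_2_eq_2)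
    then obtain i j where ij: "K = {i, j}" "i \<noteq> j"
      using card_2_iff[of K] by auto
    have nd: "\<not> p dvd x i" "\<not> p dvd x j" using K ij by auto
    obtain u v where uv: "\<not> p dvd u" "\<not> p dvd v"
      "[x i * u ^ 3 + x j * v ^ 3 = - (\<Sum>i\<in>J - K. x i)] (mod p)"
      using two_cubes_represent_2_mod_3[OF 2(3,1,2) nd, of "- (\<Sum>i\<in>J - K. x i)"] by blast
    show ?thesis
    proof (rule solve[of K "(\<lambda>_. v)(i := u)"])
      show "[(\<Sum>l\<in>K. (((\<lambda>_. v)(i := u)) l) ^ 3 * x l) = - sum x (J - K)] (mod p)"
        using uv(3) ij by (simp add: mult.commute)
    qed (use K uv in auto)
  qed
qed

lemma cube_zero_sum_admissible:
  assumes "admissible m" "finite J"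
    and "\<And>p. prime p \<Longrightarrow> p dvd m \<Longrightarrow> prime_weight p < card {i\<in>J. \<not> p dvd x i}"
  shows "cube_zero_sum m J x"
  using assms(1,3)
proof (induction m rule: admissible_induct)
  case one
  show ?case by (auto simp: cube_zero_sum_def)
next
  case (mult p m)
  have "cube_zero_sum p J x"
    using cube_zero_sum_prime[OF mult.hyps(1) assms(2)] mult.prems[of p]
      admissible_primeD[OF mult.hyps(1)] by simp
  moreover have "cube_zero_sum m J x" using mult.IH mult.prems by simp
  ultimately show ?case using cube_zero_sum_mult mult.hyps by blast
qed

text \<open>If the whole family is not a zero sum, some prime \<open>p\<close> dividing
  \<open>m\<close> has at most \<open>prime_weight p\<close> terms prime to it. More than
  \<open>total_weight (m div p)\<close> terms are then multiples of \<open>p\<close>, and dividing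
  them by \<open>p\<close> leads to a smaller modulus. This gives the upper bound for the Davenport
  constant.\<close>

lemma has_cube_zero_sum_if_card:
  assumes "admissible m" "finite J" "card J > total_weight m"
  shows "has_cube_zero_sum m J x"
  using assms
proof (induction "nat m" arbitrary: m J x rule: less_induct)
  case less
  show ?case
  proof (cases "\<forall>p. prime p \<longrightarrow> p dvd m \<longrightarrow> prime_weight p < card {i\<in>J. \<not> p dvd x i}")
    case True
    then have "cube_zero_sum m J x"
      using cube_zero_sum_admissible less.prems by blast
    moreover have "J \<noteq> {}" using less.prems by auto
    ultimately show ?thesis unfolding has_cube_zero_sum_def by blast
  next
    case False
    then obtain p where p: "prime p" "p dvd m" "card {i\<in>J. \<not> p dvd x i} \<le> prime_weight p"
      by auto
    note c = admissible_prime_cofactor[OF less.prems(1) p(1,2)]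
    define L where "L = {i\<in>J. p dvd x i}"
    have "L \<union> {i\<in>J. \<not> p dvd x i} = J" "L \<inter> {i\<in>J. \<not> p dvd x i} = {}" by (auto simp: L_def)
    then have "card J = card L + card {i\<in>J. \<not> p dvd x i}"
      using less.prems(2) card_Un_disjoint[of L "{i\<in>J. \<not> p dvd x i}"] by (simp add: L_def)
    then have "card L > total_weight (m div p)" using c(6) p(3) less.prems(3) by simp
    then have "has_cube_zero_sum (m div p) L (\<lambda>i. x i div p)"
      using less.hyps[of "m div p" L] c less.prems admissible_pos
      by (simp add: nat_less_eq_zless L_def)
    then have "has_cube_zero_sum (p * (m div p)) L x"
      using has_cube_zero_sum_scaled[OF c(4), of L x] p(1) by (auto simp: L_def)
    then show ?thesis using has_cube_zero_sum_mono[of m L x J] c(1) by (auto simp: L_def)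
  qed
qed

section \<open>Zero-sum free families of maximal length\<close>

lemma cube_zero_sum_restrict:
  assumes "finite I" and "\<And>i. i \<in> I - K \<Longrightarrow> m dvd x i" and "cube_zero_sum m I x"
  shows "cube_zero_sum m (I \<inter> K) x"
proof -
  obtain b where b: "\<forall>i\<in>I. coprime (b i) m" "m dvd (\<Sum>i\<in>I. b i ^ 3 * x i)"
    using assms(3) by (auto simp: cube_zero_sum_def)
  have "(\<Sum>i\<in>I. b i ^ 3 * x i) = (\<Sum>i\<in>I \<inter> K. b i ^ 3 * x i) + (\<Sum>i\<in>I - K. b i ^ 3 * x i)"
    using assms(1) by (rule sum.Int_Diff)
  moreover have "m dvd (\<Sum>i\<in>I - K. b i ^ 3 * x i)"
    using assms(2) by (intro dvd_sum) simp
  ultimately have "m dvd (\<Sum>i\<in>I \<inter> K. b i ^ 3 * x i)"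
    using b(2) by (simp add: dvd_add_left_iff)
  with b(1) show ?thesis by (auto simp: cube_zero_sum_def)
qed

lemma cube_zero_sum_dvd:
  assumes "cube_zero_sum m I x" "d dvd m"
  shows "cube_zero_sum d I x"
  using assms unfolding cube_zero_sum_def by (meson coprime_divisors dvd_refl dvd_trans)

text \<open>For \<open>p\<close> congruent to 1 the family is 1, \<open>c\<close> with a non-cube
  \<open>c\<close>; for \<open>p\<close> congruent to 2 a single unit is enough, as its multiples by
  units never vanish.\<close>

lemma prime_no_cube_zero_sum:
  assumes "prime p" "p mod 3 = 1 \<or> p mod 3 = 2"
  obtains y :: "nat \<Rightarrow> int"
  where "\<And>i. y i \<in> {1..<p}" "\<not> has_cube_zero_sum p {..<prime_weight p} y"
proof -
  have p: "p > 1" using assms(1) prime_gt_1_int by blast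
  obtain c where c: "c \<in> {1..<p}" "p mod 3 = 1 \<Longrightarrow> \<not> [x ^ 3 = c] (mod p)" for x
  proof (cases "p mod 3 = 1")
    case True
    then obtain c where c: "\<not> p dvd c" "\<And>x. \<not> [x ^ 3 = c] (mod p)"
      using non_cube_exists[OF assms(1)] by blast
    have "c mod p \<noteq> 0" "0 \<le> c mod p" "c mod p < p" using c(1) p by auto
    then have "c mod p \<in> {1..<p}" unfolding atLeastLessThan_iff by linarith
    moreover have "\<not> [x ^ 3 = c mod p] (mod p)" for x using c(2) by (simp add: cong_def)
    ultimately show thesis using that by blast
  next
    case False
    then show thesis using that[of 1] p by simp
  qed
  \<comment> \<open>Only the first \<open>prime_weight p\<close> values belong to the family; the
    others repeat \<open>c\<close> to keep every value in range.\<close>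
  define y where "y i = (if i = 0 then 1 else c)" for i :: nat
  have y: "y i \<in> {1..<p}" for i using c p by (simp add: y_def)
  have "\<not> has_cube_zero_sum p {..<prime_weight p} y"
  proof
    assume "has_cube_zero_sum p {..<prime_weight p} y"
    then obtain I b where I: "I \<subseteq> {..<prime_weight p}" "I \<noteq> {}" "\<forall>i\<in>I. coprime (b i) p"
      "p dvd (\<Sum>i\<in>I. b i ^ 3 * y i)"
      unfolding has_cube_zero_sum_def cube_zero_sum_def by blast
    have nd: "\<not> p dvd b i" if "i \<in> I" for i
      using I(3) that p coprime_absorb_right[of p "b i"] by auto
    have single: "I \<noteq> {i}" for i
    proof
      assume "I = {i}"
      then have "p dvd b i ^ 3 * y i" "\<not> p dvd b i" using I(4) nd by auto
      then have "p dvd y i"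
        using assms(1) by (simp add: prime_dvd_mult_iff prime_dvd_power_iff)
      then show False using y[of i] zdvd_not_zless[of "y i" p] by auto
    qed
    have "prime_weight p = 2 \<and> p mod 3 = 1 \<or> prime_weight p = 1"
      by (simp add: prime_weight_def)
    then show False
    proof
      assume w: "prime_weight p = 2 \<and> p mod 3 = 1"
      then have "I \<subseteq> {0, 1}" using I(1) by auto
      then have "I = {0, 1}" using single[of 0] single[of 1] I(2) by blast
      then have dvd: "p dvd b 0 ^ 3 + b 1 ^ 3 * c" and "\<not> p dvd b 1"
        using I(4) nd by (auto simp: y_def)
      then have "coprime (b 1) p" using I(3) \<open>I = {0, 1}\<close> by blast
      then obtain d where d: "[b 1 * d = 1] (mod p)" using cong_solve_coprime_int by blast
      \<comment> \<open>As \<open>d\<close> is inverse to \<open>b 1\<close>, the zero sum would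
        make \<open>- b 0 * d\<close> a cube root of \<open>c\<close>.\<close>
      have "[(- b 0 * d) ^ 3 = (b 1 * d) ^ 3 * c] (mod p)"
      proof -
        have "(b 1 * d) ^ 3 * c - (- b 0 * d) ^ 3 = d ^ 3 * (b 0 ^ 3 + b 1 ^ 3 * c)"
          by (simp add: power3_eq_cube algebra_simps)
        then have "p dvd (b 1 * d) ^ 3 * c - (- b 0 * d) ^ 3" using dvd by simp
        then show ?thesis by (metis cong_iff_dvd_diff cong_sym)
      qed
      also have "[(b 1 * d) ^ 3 * c = 1 ^ 3 * c] (mod p)"
        by (intro cong_mult cong_pow d cong_refl)
      finally have "[(- b 0 * d) ^ 3 = c] (mod p)" by simp
      then show False using c(2) w by blast
    next
      assume "prime_weight p = 1"
      then have "I = {0}" using I(1,2) by auto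
      then show False using single by blast
    qed
  qed
  with y that show thesis by blast
qed

text \<open>A family for \<open>p\<close> is followed by \<open>p\<close> times a family for
  \<open>m\<close>. Modulo \<open>p\<close> only the first block counts, so a zero sum avoids it;
  what remains can be divided by \<open>p\<close>. This gives the lower bound for the Davenport
  constant.\<close>

lemma exists_no_cube_zero_sum:
  assumes "admissible m"
  obtains x :: "nat \<Rightarrow> int"
  where "\<And>i. x i \<in> {0..<m}" "\<not> has_cube_zero_sum m {..<total_weight m} x"
proof -
  have "\<exists>x :: nat \<Rightarrow> int. (\<forall>i. x i \<in> {0..<m}) \<and> \<not> has_cube_zero_sum m {..<total_weight m} x"
    using assms
  proof (induction m rule: admissible_induct)
    case one
    show ?case by (intro exI[of _ "\<lambda>_. 0"]) (simp add: has_cube_zero_sum_def)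
  next
    case (mult p m)
    then obtain x :: "nat \<Rightarrow> int" where x: "\<forall>i. x i \<in> {0..<m}"
      "\<not> has_cube_zero_sum m {..<total_weight m} x" by blast
    have prime: "prime p" and p: "p > 1"
      using mult.hyps(1) admissible_primeD prime_gt_1_int by blast+
    obtain y :: "nat \<Rightarrow> int" where y: "\<And>i. y i \<in> {1..<p}"
      "\<not> has_cube_zero_sum p {..<prime_weight p} y"
      using prime_no_cube_zero_sum[OF prime] mult.hyps(1) by (auto simp: admissible_prime_def)
    define w where "w = prime_weight p"
    define z where "z i = (if i < w then y i else p * x (i - w))" for i
    have m: "m > 0" using mult.hyps(2) by (rule admissible_pos)
    have W: "total_weight (p * m) = w + total_weight m"
      using total_weight_mult[of p m] total_weight_prime[OF prime] p m by (simp add: w_def)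
    have "z i \<in> {0..<p * m}" for i
    proof -
      have "y i < p * m"
        using y(1)[of i] m p mult_left_mono[of 1 m p] by (auto intro: order_less_le_trans)
      then show ?thesis using x(1) y(1)[of i] p by (auto simp: z_def)
    qed
    moreover have "\<not> has_cube_zero_sum (p * m) {..<total_weight (p * m)} z"
    proof
      assume "has_cube_zero_sum (p * m) {..<total_weight (p * m)} z"
      then obtain I where I: "I \<subseteq> {..<w + total_weight m}" "I \<noteq> {}" "cube_zero_sum (p * m) I z"
        unfolding has_cube_zero_sum_def W by blast
      have "finite I" using I(1) finite_subset by blast
      have "cube_zero_sum p (I \<inter> {..<w}) z"
      proof (rule cube_zero_sum_restrict[OF \<open>finite I\<close>])
        show "cube_zero_sum p I z" using cube_zero_sum_dvd[OF I(3)] by simp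
      qed (simp add: z_def)
      then have "cube_zero_sum p (I \<inter> {..<w}) y"
        by (subst (asm) cube_zero_sum_cong[OF refl, of _ z y]) (auto simp: z_def)
      then have empty: "I \<inter> {..<w} = {}"
        using y(2) unfolding has_cube_zero_sum_def w_def by (meson Int_lower2)
      \<comment> \<open>The selected indices are now all at least \<open>w\<close> and are shifted
        back to address \<open>x\<close>.\<close>
      define I' where "I' = (\<lambda>i. i - w) ` I"
      have I_eq: "I = (\<lambda>i. i + w) ` I'"
      proof -
        have "i - w + w = i" if "i \<in> I" for i using empty that by auto
        then show ?thesis by (simp add: I'_def image_image)
      qed
      have "cube_zero_sum (p * m) I' (\<lambda>i. z (i + w))"
        using I(3) unfolding I_eq by (subst (asm) cube_zero_sum_image) (auto simp: inj_on_def)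
      then have "cube_zero_sum m I' (\<lambda>i. z (i + w) div p)"
        using cube_zero_sum_scaled[OF mult.hyps(3), of I' "\<lambda>i. z (i + w)"] p
        by (simp add: z_def)
      then have "cube_zero_sum m I' x" using p by (simp add: z_def)
      moreover have "i - w < total_weight m" if "i \<in> I" for i
      proof -
        have "i < w + total_weight m" "\<not> i < w" using that I(1) empty by auto
        then show ?thesis by linarith
      qed
      then have "I' \<subseteq> {..<total_weight m}" by (auto simp: I'_def)
      moreover have "I' \<noteq> {}" using I(2) by (simp add: I'_def)
      ultimately show False using x(2) unfolding has_cube_zero_sum_def by blast
    qed
    ultimately show ?case by blast
  qed
  with that show thesis by blast
qed

section \<open>From indexed families to multisets\<close>

lemma Zmod_units_iff:
  assumes "m > 0"
  shows "a \<in> Zmod_units m \<longleftrightarrow> 0 \<le> a \<and> a < m \<and> coprime a m"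
proof -
  have "(\<exists>b\<in>{0..<m}. [a * b = 1] (mod m)) \<longleftrightarrow> (\<exists>b. [a * b = 1] (mod m))"
  proof
    assume "\<exists>b. [a * b = 1] (mod m)"
    then obtain b where "[a * b = 1] (mod m)" by blast
    then have "[a * (b mod m) = 1] (mod m)" by (simp add: cong_def mod_mult_right_eq)
    moreover have "b mod m \<in> {0..<m}" using assms by simp
    ultimately show "\<exists>b\<in>{0..<m}. [a * b = 1] (mod m)" by blast
  qed blast
  then show ?thesis
    using coprime_iff_invertible_int[of a m] by (auto simp: Zmod_units_def Zmod_def)
qed

lemma unit_cubes_iff:
  assumes "m > 0"
  shows "a \<in> unit_cubes m \<longleftrightarrow> (\<exists>b. coprime b m \<and> a = b ^ 3 mod m)"
proof
  assume "\<exists>b. coprime b m \<and> a = b ^ 3 mod m"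
  then obtain b where b: "coprime b m" "a = b ^ 3 mod m" by blast
  have "b mod m \<in> Zmod_units m"
    using assms b(1) by (simp add: Zmod_units_iff)
  moreover have "a = (b mod m) ^ 3 mod m" using b(2) by (simp add: power_mod)
  ultimately show "a \<in> unit_cubes m" unfolding unit_cubes_def by blast
qed (auto simp: unit_cubes_def Zmod_units_iff[OF assms])

text \<open>A weighted zero sum comes with an arbitrary ordering of its values; this lifts such an
  ordering to the indices behind them.\<close>

lemma mset_eq_image_msetE:
  assumes "mset xs = image_mset f M"
  obtains ys where "map f ys = xs" "mset ys = M"
proof -
  have "\<exists>ys. map f ys = xs \<and> mset ys = M"
    using assms
  proof (induction xs arbitrary: M)
    case (Cons x xs)
    then have "image_mset f M = {#x#} + mset xs" by simp
    then obtain B C where BC: "M = B + C" "{#x#} = image_mset f B" "mset xs = image_mset f C"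
      using image_mset_eq_plusD by metis
    obtain y where "B = {#y#}" "f y = x"
      using BC(2) by (metis image_mset_single msed_map_invR size_1_singleton_mset size_image_mset size_single single_eq_single)
    moreover obtain ys where "map f ys = xs" "mset ys = C" using Cons.IH BC(3) by blast
    ultimately show ?case using BC(1) by (intro exI[of _ "y # ys"]) simp
  qed simp
  with that show thesis by blast
qed

lemma weighted_zero_sum_image_mset:
  assumes "m > 0" "finite I"
  shows "weighted_zero_sum m (unit_cubes m) (image_mset x (mset_set I)) \<longleftrightarrow> cube_zero_sum m I x"
proof
  assume "weighted_zero_sum m (unit_cubes m) (image_mset x (mset_set I))"
  then obtain xs as where xs: "mset xs = image_mset x (mset_set I)" and
    as: "length as = length xs" "set as \<subseteq> unit_cubes m" and
    sum: "[(\<Sum>k<length xs. as ! k * xs ! k) = 0] (mod m)"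
    unfolding weighted_zero_sum_def by blast
  obtain ks where ks: "mset ks = mset_set I" "map x ks = xs"
    using mset_eq_image_msetE[OF xs] by metis
  have "set ks = I" using assms(2) arg_cong[OF ks(1), of set_mset] by simp
  moreover have "length ks = card I" using arg_cong[OF ks(1), of size] by simp
  ultimately have "distinct ks" by (metis card_distinct)
  then have bij: "bij_betw ((!) ks) {..<length ks} I"
    using \<open>set ks = I\<close> bij_betw_nth[of ks] by blast
  have "\<exists>b. coprime b m \<and> as ! k = b ^ 3 mod m" if "k < length ks" for k
  proof -
    have "as ! k \<in> set as" using as(1) ks(2) that by auto
    then show ?thesis using as(2) unit_cubes_iff[OF assms(1)] by blast
  qed
  then obtain b where b: "\<And>k. k < length ks \<Longrightarrow> coprime (b k) m \<and> as ! k = b k ^ 3 mod m"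
    by metis
  \<comment> \<open>The weights are given by position in the list; \<open>c\<close> transfers them
    to the indices, each of which occurs at exactly one position.\<close>
  define c where "c i = b (the_inv_into {..<length ks} ((!) ks) i)" for i
  have c: "c (ks ! k) = b k" if "k < length ks" for k
    using bij that by (simp add: c_def bij_betw_def the_inv_into_f_f)
  have "(\<Sum>i\<in>I. c i ^ 3 * x i) = (\<Sum>k<length ks. b k ^ 3 * xs ! k)"
    unfolding sum.reindex_bij_betw[OF bij, symmetric] using ks(2) c
    by (intro sum.cong) auto
  also have "[\<dots> = (\<Sum>k<length ks. as ! k * xs ! k)] (mod m)"
    using b by (intro cong_sum cong_mult cong_refl) (auto simp: cong_def)
  also have "[(\<Sum>k<length ks. as ! k * xs ! k) = 0] (mod m)" using sum ks(2) by auto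
  finally have "m dvd (\<Sum>i\<in>I. c i ^ 3 * x i)" by (simp add: cong_0_iff)
  moreover have "coprime (c i) m" if "i \<in> I" for i
    using that b c \<open>set ks = I\<close> by (metis in_set_conv_nth)
  ultimately show "cube_zero_sum m I x" by (auto simp: cube_zero_sum_def)
next
  assume "cube_zero_sum m I x"
  then obtain b where b: "\<forall>i\<in>I. coprime (b i) m" "m dvd (\<Sum>i\<in>I. b i ^ 3 * x i)"
    by (auto simp: cube_zero_sum_def)
  obtain ks where ks: "distinct ks" "set ks = I"
    using finite_distinct_list[OF assms(2)] by blast
  have bij: "bij_betw ((!) ks) {..<length ks} I"
    using ks bij_betw_nth[of ks] by blast
  show "weighted_zero_sum m (unit_cubes m) (image_mset x (mset_set I))"
    unfolding weighted_zero_sum_def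
  proof (intro exI conjI)
    show "mset (map x ks) = image_mset x (mset_set I)"
      using ks by (metis mset_map mset_set_set)
    show "length (map (\<lambda>i. b i ^ 3 mod m) ks) = length (map x ks)" by simp
    show "set (map (\<lambda>i. b i ^ 3 mod m) ks) \<subseteq> unit_cubes m"
      using b(1) ks(2) unit_cubes_iff[OF assms(1)] by auto
    have "[(\<Sum>k<length ks. (b (ks ! k) ^ 3 mod m) * x (ks ! k)) =
        (\<Sum>k<length ks. b (ks ! k) ^ 3 * x (ks ! k))] (mod m)"
      by (intro cong_sum cong_mult cong_refl) (simp add: cong_def)
    also have "(\<Sum>k<length ks. b (ks ! k) ^ 3 * x (ks ! k)) = (\<Sum>i\<in>I. b i ^ 3 * x i)"
      by (rule sum.reindex_bij_betw[OF bij])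
    also have "[\<dots> = 0] (mod m)" using b(2) by (simp add: cong_0_iff)
    finally show "[(\<Sum>k<length (map x ks). map (\<lambda>i. b i ^ 3 mod m) ks ! k * map x ks ! k) = 0] (mod m)"
      by simp
  qed
qed

lemma subseteq_image_msetE:
  assumes "R \<subseteq># image_mset f M"
  obtains N where "N \<subseteq># M" "R = image_mset f N"
proof -
  obtain R' where "image_mset f M = R + R'" using assms by (auto simp: subset_mset.le_iff_add)
  then obtain N N' where "M = N + N'" "R = image_mset f N"
    using image_mset_eq_plusD by metis
  then show thesis using that[of N] by simp
qed

lemma has_zero_sum_subsequence_image_mset:
  assumes "m > 0" "finite J"
  shows "has_zero_sum_subsequence m (unit_cubes m) (image_mset x (mset_set J)) \<longleftrightarrow>
    has_cube_zero_sum m J x"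
proof
  assume "has_zero_sum_subsequence m (unit_cubes m) (image_mset x (mset_set J))"
  then obtain R where R: "R \<subseteq># image_mset x (mset_set J)" "R \<noteq> {#}"
    "weighted_zero_sum m (unit_cubes m) R"
    unfolding has_zero_sum_subsequence_def by blast
  obtain N where N: "N \<subseteq># mset_set J" "R = image_mset x N"
    using R(1) by (rule subseteq_image_msetE)
  define I where "I = set_mset N"
  \<comment> \<open>Multiplicities in \<open>mset_set J\<close> are at most 1, hence also in
    \<open>N\<close>, so \<open>N\<close> amounts to a set of indices.\<close>
  have I: "N = mset_set I" "I \<subseteq> J"
  proof -
    show "I \<subseteq> J" using N(1) assms(2) set_mset_mono[OF N(1)] by (simp add: I_def)
    have "count N i = count (mset_set I) i" for i
    proof (cases "i \<in># N")
      case True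
      have "count N i = 1"
      proof (rule antisym)
        show "count N i \<le> 1"
          using mset_subset_eq_count[OF N(1), of i] by (simp add: count_mset_set' split: if_splits)
      qed (use True in simp)
      then show ?thesis using True by (simp add: I_def)
    qed (simp add: I_def not_in_iff)
    then show "N = mset_set I" by (rule multiset_eqI)
  qed
  have "finite I" by (simp add: I_def)
  have "cube_zero_sum m I x"
    using R(3) unfolding N(2) I(1) weighted_zero_sum_image_mset[OF assms(1) \<open>finite I\<close>] .
  moreover have "I \<noteq> {}" using R(2) N(2) by (auto simp: I_def)
  ultimately show "has_cube_zero_sum m J x"
    using I(2) unfolding has_cube_zero_sum_def by blast
next
  assume "has_cube_zero_sum m J x"
  then obtain I where I: "I \<subseteq> J" "I \<noteq> {}" "cube_zero_sum m I x"
    unfolding has_cube_zero_sum_def by blast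
  have fin: "finite I" using I(1) assms(2) finite_subset by blast
  have "image_mset x (mset_set I) \<subseteq># image_mset x (mset_set J)"
    using I(1) assms(2) fin by (intro image_mset_subseteq_mono) simp
  moreover have "image_mset x (mset_set I) \<noteq> {#}" using I(2) fin by (simp add: mset_set_empty_iff)
  ultimately show "has_zero_sum_subsequence m (unit_cubes m) (image_mset x (mset_set J))"
    using I(3) weighted_zero_sum_image_mset[OF assms(1) fin]
    unfolding has_zero_sum_subsequence_def by blast
qed

lemma multiset_indexed:
  obtains x :: "nat \<Rightarrow> 'a" where "S = image_mset x (mset_set {..<size S})"
proof -
  obtain xs where xs: "mset xs = S" using ex_mset by blast
  have "mset xs = image_mset ((!) xs) (mset [0..<length xs])"
    by (metis map_nth mset_map)
  also have "mset [0..<length xs] = mset_set {..<length xs}"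
    by (simp add: atLeast0LessThan)
  finally show thesis using that[of "(!) xs"] xs by auto
qed

section \<open>The Davenport constant and extremal families\<close>

lemma davenport_unit_cubes:
  assumes "admissible m"
  shows "davenport m (unit_cubes m) = total_weight m + 1"
  unfolding davenport_def
proof (rule Least_equality)
  have m: "m > 0" using assms by (rule admissible_pos)
  show "0 < total_weight m + 1 \<and> (\<forall>S. sequence_over m S \<and> size S = total_weight m + 1 \<longrightarrow>
      has_zero_sum_subsequence m (unit_cubes m) S)"
  proof (intro conjI allI impI)
    fix S :: "int multiset"
    assume S: "sequence_over m S \<and> size S = total_weight m + 1"
    obtain x where x: "S = image_mset x (mset_set {..<size S})" by (rule multiset_indexed)
    have "has_cube_zero_sum m {..<size S} x"
      by (rule has_cube_zero_sum_if_card[OF assms]) (use S in simp_all)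
    then show "has_zero_sum_subsequence m (unit_cubes m) S"
      using has_zero_sum_subsequence_image_mset[OF m finite_lessThan] x by metis
  qed simp
  \<comment> \<open>With \<open>l \<le> total_weight m\<close>, already the first \<open>l\<close>
    terms of the zero-sum free family would contain a zero sum.\<close>
  fix l assume l: "0 < l \<and> (\<forall>S. sequence_over m S \<and> size S = l \<longrightarrow>
      has_zero_sum_subsequence m (unit_cubes m) S)"
  obtain x :: "nat \<Rightarrow> int" where x: "\<And>i. x i \<in> {0..<m}"
    "\<not> has_cube_zero_sum m {..<total_weight m} x"
    using exists_no_cube_zero_sum[OF assms] by blast
  have "sequence_over m (image_mset x (mset_set {..<l}))"
    using x(1) by (auto simp: sequence_over_def Zmod_def)
  then have "has_zero_sum_subsequence m (unit_cubes m) (image_mset x (mset_set {..<l}))"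
    using l by simp
  then have "has_cube_zero_sum m {..<l} x"
    using has_zero_sum_subsequence_image_mset[OF m finite_lessThan] by blast
  then show "total_weight m + 1 \<le> l"
    using x(2) has_cube_zero_sum_mono[of m "{..<l}" x "{..<total_weight m}"] by fastforce
qed

lemma extremal_structure:
  assumes "admissible n" "n > 1" "finite J" "card J = total_weight n"
    and no_sum: "\<not> has_cube_zero_sum n J x"
  obtains p where "prime p" "p dvd n" "card {i\<in>J. \<not> p dvd x i} = prime_weight p"
    "\<not> has_cube_zero_sum (n div p) {i\<in>J. p dvd x i} (\<lambda>i. x i div p)"
    "\<not> has_cube_zero_sum p {i\<in>J. \<not> p dvd x i} x"
proof -
  \<comment> \<open>Since \<open>n > 1\<close>, some prime contributes to \<open>card J\<close>;
    thus \<open>J\<close> is non-empty and itself excluded as a zero sum.\<close>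
  have "\<not> cube_zero_sum n J x"
  proof
    assume "cube_zero_sum n J x"
    moreover obtain q where "prime q" "q dvd n"
      using prime_divisor_exists[of n] assms(2) by auto
    then have "card J > 0"
      using admissible_prime_cofactor(6)[OF assms(1)] prime_weight_pos[of q] assms(4) by simp
    then have "J \<noteq> {}" by auto
    ultimately show False using no_sum unfolding has_cube_zero_sum_def by blast
  qed
  then obtain p where p: "prime p" "p dvd n" "card {i\<in>J. \<not> p dvd x i} \<le> prime_weight p"
    using cube_zero_sum_admissible[OF assms(1,3)] by (meson not_less)
  note c = admissible_prime_cofactor[OF assms(1) p(1,2)]
  define m where "m = n div p"
  note c = c[folded m_def]
  define K L where "K = {i\<in>J. \<not> p dvd x i}" and "L = {i\<in>J. p dvd x i}"
  have KL: "K \<inter> L = {}" "K \<union> L = J" "finite K" "finite L"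
    using assms(3) by (auto simp: K_def L_def)
  then have cardJ: "card J = card K + card L" by (metis card_Un_disjoint)
  have p0: "p \<noteq> 0" using p(1) by auto
  have no_L: "\<not> has_cube_zero_sum m L (\<lambda>i. x i div p)"
  proof
    assume "has_cube_zero_sum m L (\<lambda>i. x i div p)"
    then have "has_cube_zero_sum n L x"
      using has_cube_zero_sum_scaled[OF c(4) p0, of L x] c(1) by (simp add: L_def)
    then show False using no_sum has_cube_zero_sum_mono KL(2) by blast
  qed
  then have "card L \<le> total_weight m"
    using has_cube_zero_sum_if_card[OF c(3) KL(4)] by (meson not_less)
  \<comment> \<open>The two cardinalities are bounded by the two summands of
    \<open>total_weight n\<close> and add up to it, so both bounds are attained.\<close>
  then have cardK: "card K = prime_weight p" and cardL: "card L = total_weight m"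
    using cardJ assms(4) c(6) p(3) by (simp_all add: K_def)
  have no_K: "\<not> has_cube_zero_sum p K x"
  proof
    assume "has_cube_zero_sum p K x"
    then obtain I a where I: "I \<subseteq> K" "I \<noteq> {}" "\<forall>i\<in>I. coprime (a i) p"
      "p dvd (\<Sum>i\<in>I. a i ^ 3 * x i)"
      unfolding has_cube_zero_sum_def cube_zero_sum_def by blast
    have finI: "finite I" using I(1) KL(3) finite_subset by blast
    \<comment> \<open>Weights that are units modulo \<open>p\<close> are lifted to units modulo
      \<open>n\<close>; the residue 1 modulo \<open>m\<close> is an arbitrary choice.\<close>
    have "\<exists>b. \<forall>i\<in>I. coprime (b i) (p * m) \<and> [b i = a i] (mod p) \<and> [b i = 1] (mod m)"
      using I(3) by (intro unit_chinese_remainder c(4)) simp_all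
    then obtain b where b: "\<And>i. i \<in> I \<Longrightarrow> coprime (b i) (p * m)" "\<And>i. i \<in> I \<Longrightarrow> [b i = a i] (mod p)"
      by blast
    define z where "z = (\<Sum>i\<in>I. b i ^ 3 * x i)"
    have "p dvd z \<longleftrightarrow> p dvd (\<Sum>i\<in>I. a i ^ 3 * x i)"
      unfolding z_def by (intro cong_dvd_iff cong_sum cong_mult cong_pow cong_refl b)
    with I(4) have pz: "p dvd z" by simp
    obtain k where k: "k \<in> I" using I(2) by blast
    have kL: "k \<notin> L" using k I(1) KL(1) by blast
    \<comment> \<open>The combination \<open>z\<close> replaces the term at a position
      \<open>k\<close> of \<open>I\<close>. Together with those in \<open>L\<close> this makes
      \<open>total_weight m + 1\<close> multiples of \<open>p\<close>, one too many.\<close>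
    define y where "y = x(k := z)"
    have "has_cube_zero_sum m (insert k L) (\<lambda>i. y i div p)"
      by (rule has_cube_zero_sum_if_card[OF c(3)]) (use KL(4) kL cardL in simp_all)
    moreover have "p dvd y i" if "i \<in> insert k L" for i
      using that pz by (auto simp: y_def L_def)
    ultimately have "has_cube_zero_sum n (insert k L) y"
      using has_cube_zero_sum_scaled[OF c(4) p0, of "insert k L" y] c(1) by simp
    then obtain M d where M: "M \<subseteq> insert k L" "M \<noteq> {}" "\<forall>i\<in>M. coprime (d i) n"
      "n dvd (\<Sum>i\<in>M. d i ^ 3 * y i)"
      unfolding has_cube_zero_sum_def cube_zero_sum_def by blast
    show False
    proof (cases "k \<in> M")
      case False
      then have "(\<Sum>i\<in>M. d i ^ 3 * y i) = (\<Sum>i\<in>M. d i ^ 3 * x i)"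
        by (intro sum.cong) (auto simp: y_def)
      then have "cube_zero_sum n M x" using M unfolding cube_zero_sum_def by metis
      moreover have "M \<subseteq> J" using M(1) False KL(2) by blast
      ultimately show False using no_sum M(2) unfolding has_cube_zero_sum_def by blast
    next
      case True
      define N where "N = M - {k}"
      have N: "N \<subseteq> L" "I \<inter> N = {}" "finite N"
        using M(1) I(1) KL finite_subset[of N L] by (auto simp: N_def)
      \<comment> \<open>A zero sum that uses \<open>z\<close> with weight \<open>d k\<close> becomes
        one of original terms when \<open>d k\<close> is distributed over the terms in
        \<open>I\<close>.\<close>
      define e where "e i = (if i \<in> I then d k * b i else d i)" for i
      have "(\<Sum>i\<in>I \<union> N. e i ^ 3 * x i) = (\<Sum>i\<in>I. e i ^ 3 * x i) + (\<Sum>i\<in>N. e i ^ 3 * x i)"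
        using sum.union_disjoint[OF finI N(3,2)] .
      also have "(\<Sum>i\<in>I. e i ^ 3 * x i) = d k ^ 3 * z"
        unfolding z_def sum_distrib_left
        by (intro sum.cong) (auto simp: e_def power_mult_distrib mult.assoc)
      also have "(\<Sum>i\<in>N. e i ^ 3 * x i) = (\<Sum>i\<in>N. d i ^ 3 * y i)"
        using N(2) by (intro sum.cong) (auto simp: e_def y_def N_def)
      also have "d k ^ 3 * z + (\<Sum>i\<in>N. d i ^ 3 * y i) = (\<Sum>i\<in>M. d i ^ 3 * y i)"
        using True N(3) by (subst sum.remove[of M k]) (auto simp: N_def y_def)
      finally have "n dvd (\<Sum>i\<in>I \<union> N. e i ^ 3 * x i)" using M(4) by simp
      moreover have "coprime (e i) n" if "i \<in> I \<union> N" for i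
        using that M(3) True b(1) c(1) by (auto simp: e_def N_def)
      ultimately have "cube_zero_sum n (I \<union> N) x" unfolding cube_zero_sum_def by blast
      moreover have "I \<union> N \<subseteq> J" "I \<union> N \<noteq> {}" using I N(1) KL(2) by auto
      ultimately show False using no_sum unfolding has_cube_zero_sum_def by blast
    qed
  qed
  show thesis
    using that[OF p(1,2)] cardK no_L no_K unfolding K_def L_def m_def by blast
qed

text \<open>The theorem needs only this trivial equivalence, since its list is a suitable ordering
  of \<open>S\<close>. Being canonical residues, the terms are fixed by reduction modulo
  \<open>m\<close>.\<close>

lemma equivalent_sequences_refl:
  assumes "m > 1" "sequence_over m S"
  shows "equivalent_sequences m (unit_cubes m) S S"
proof -
  obtain xs where xs: "mset xs = S" using ex_mset by blast
  have "1 \<in> unit_cubes m" using assms(1) unit_cubes_iff[of m 1] by (auto intro!: exI[of _ 1])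
  moreover have "1 \<in> Zmod_units m" using assms(1) Zmod_units_iff[of m 1] by simp
  moreover have "xs ! i = (1 * replicate (length xs) 1 ! i * xs ! id i) mod m" if "i < length xs" for i
  proof -
    have "xs ! i \<in> Zmod m"
      using assms(2) xs that by (auto simp: sequence_over_def)
    then show ?thesis using that by (simp add: Zmod_def)
  qed
  ultimately show ?thesis
    unfolding equivalent_sequences_def using xs permutes_id
    by (intro exI[of _ xs] exI[of _ "replicate (length xs) 1"] exI[of _ "1::int"] exI[of _ id]) auto
qed

lemma total_weight_prod:
  assumes "\<And>i. i \<in> A \<Longrightarrow> prime (f i)" "\<And>i. i \<in> A \<Longrightarrow> prime_weight (f i) = k"
  shows "total_weight (\<Prod>i\<in>A. f i) = k * Omega (\<Prod>i\<in>A. f i)"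
proof (cases "finite A")
  case True
  then show ?thesis using assms
  proof (induction A)
    case (insert a A)
    have "(\<Prod>i\<in>A. f i) \<noteq> 0" "f a \<noteq> 0" using insert by fastforce+
    moreover have "prime_factorization (f a) = {#f a#}"
      using insert by (intro prime_factorization_prime) simp
    ultimately show ?case
      using insert by (simp add: total_weight_mult total_weight_prime Omega_def prime_factorization_mult)
  qed (simp add: Omega_def)
qed (simp add: Omega_def)

section \<open>The structure of extremal sequences\<close>

lemma total_weight_eq_Omega:
  fixes ps qs :: "nat \<Rightarrow> int"
  assumes "n1 = (\<Prod>i=1..r. ps i)" and "n2 = (\<Prod>j=1..s. qs j)"
    and "\<And>i. i \<in> {1..r} \<Longrightarrow> prime (ps i) \<and> [ps i = 1] (mod 3)"
    and "\<And>j. j \<in> {1..s} \<Longrightarrow> prime (qs j) \<and> [qs j = 2] (mod 3)"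
  shows "total_weight (n1 * n2) = 2 * Omega n1 + Omega n2"
proof -
  have "ps i \<noteq> 0" if "i \<in> {1..r}" for i using assms(3)[OF that] by auto
  then have "n1 \<noteq> 0" by (simp add: assms(1))
  moreover have "qs j \<noteq> 0" if "j \<in> {1..s}" for j using assms(4)[OF that] by auto
  then have "n2 \<noteq> 0" by (simp add: assms(2))
  moreover have "total_weight n1 = 2 * Omega n1"
    unfolding assms(1)
    by (rule total_weight_prod) (use assms(3) in \<open>auto simp: prime_weight_def cong_def\<close>)
  moreover have "total_weight n2 = 1 * Omega n2"
    unfolding assms(2)
    by (rule total_weight_prod) (use assms(4) in \<open>auto simp: prime_weight_def cong_def\<close>)
  ultimately show ?thesis by (simp add: total_weight_mult)
qed

lemma prime_dvd_prod_cong: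
  fixes f :: "nat \<Rightarrow> int"
  assumes "prime p" "p dvd (\<Prod>i\<in>A. f i)" "\<And>i. i \<in> A \<Longrightarrow> prime (f i) \<and> [f i = c] (mod 3)"
  shows "[p = c] (mod 3)"
proof (cases "finite A")
  case True
  then obtain i where "i \<in> A" "p dvd f i"
    using assms(1,2) prime_dvd_prod_iff by blast
  then show ?thesis using assms(1,3) primes_dvd_imp_eq by metis
next
  case False
  then show ?thesis using assms(1,2) not_prime_unit by auto
qed

lemma extremal_sequence_image_mset:
  assumes "admissible m" "finite J" "card J = total_weight m" "\<And>i. i \<in> J \<Longrightarrow> x i \<in> {0..<m}"
    "\<not> has_cube_zero_sum m J x"
  shows "extremal_sequence m (unit_cubes m) (image_mset x (mset_set J))"
  using assms has_zero_sum_subsequence_image_mset[OF admissible_pos[OF assms(1)] assms(2)]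
  by (auto simp: extremal_sequence_def davenport_unit_cubes sequence_over_def Zmod_def)

lemma admissible_self: "admissible_prime p \<Longrightarrow> admissible p"
  using primes_dvd_imp_eq[of _ p] prime_gt_0_int[of p] squarefree_prime[of p]
  by (auto simp: admissible_def admissible_prime_def)

theorem theorem1p2:
  fixes n n1 n2 :: int and ps qs :: "nat \<Rightarrow> int" and r s :: nat
    and S :: "int multiset"
  assumes "n = n1 * n2" and "n > 1" and "squarefree n" and "odd n"
    and "\<not> 7 dvd n" and "\<not> 13 dvd n"
    and "n1 = (\<Prod>i=1..r. ps i)" and "n2 = (\<Prod>j=1..s. qs j)"
    and "\<And>i. i \<in> {1..r} \<Longrightarrow> prime (ps i) \<and> [ps i = 1] (mod 3)"
    and "\<And>j. j \<in> {1..s} \<Longrightarrow> prime (qs j) \<and> [qs j = 2] (mod 3)"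
    and "sequence_over n S"
    and "size S = davenport n (unit_cubes n) - 1"
    and "\<not> has_zero_sum_subsequence n (unit_cubes n) S"
  shows "davenport n (unit_cubes n) - 1 = 2 * Omega n1 + Omega n2 \<and>
    (\<exists>xs. equivalent_sequences n (unit_cubes n) S (mset xs) \<and>
      ((\<exists>p ys. prime p \<and> p dvd n1 \<and>
          {i. i < length xs \<and> \<not> p dvd xs ! i} = {0, 1} \<and>
          drop 2 xs = map (\<lambda>y. p * y) ys \<and>
          extremal_sequence (n div p) (unit_cubes (n div p)) (mset ys) \<and>
          extremal_sequence p (unit_cubes p) {#xs ! 0 mod p, xs ! 1 mod p#})
       \<or>
       (\<exists>p ys. prime p \<and> p dvd n2 \<and>
          {i. i < length xs \<and> \<not> p dvd xs ! i} = {0} \<and>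
          drop 1 xs = map (\<lambda>y. p * y) ys \<and>
          extremal_sequence (n div p) (unit_cubes (n div p)) (mset ys))))"
proof -
  have cases: "p dvd n1 \<and> [p = 1] (mod 3) \<or> p dvd n2 \<and> [p = 2] (mod 3)"
    if "prime p" "p dvd n" for p
  proof -
    have "p dvd n1 \<or> p dvd n2" using that assms(1) prime_dvd_mult_iff by blast
    then show ?thesis using prime_dvd_prod_cong that(1) assms(7-10) by blast
  qed
  have "admissible_prime p" if p: "prime p" "p dvd n" for p
  proof -
    have gt: "p > 1" using p(1) prime_gt_1_int by blast
    have ne: "odd p" "p \<noteq> 7" "p \<noteq> 13" using p(2) assms(4-6) dvd_trans by auto
    have "p mod 3 = 1 \<or> p mod 3 = 2" using cases[OF p] by (auto simp: cong_def)
    \<comment> \<open>An odd number above 1 that is 1 modulo 3 is 7, 13 or at least 19; one that is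
      2 modulo 3 is at least 5.\<close>
    moreover have "p \<ge> 19" if "p mod 3 = 1" using that gt ne by presburger
    moreover have "p \<ge> 5" if "p mod 3 = 2" using that gt ne by presburger
    ultimately show ?thesis using p(1) by (auto simp: admissible_prime_def)
  qed
  then have adm: "admissible n" using assms(2,3) by (simp add: admissible_def)
  have dav: "davenport n (unit_cubes n) - 1 = total_weight n"
    using davenport_unit_cubes[OF adm] by simp
  define J where "J = {..<size S}"
  obtain x where x: "S = image_mset x (mset_set J)"
    unfolding J_def by (rule multiset_indexed)
  have J: "finite J" "card J = total_weight n" using assms(12) dav by (simp_all add: J_def)
  have x_range: "x i \<in> {0..<n}" if "i \<in> J" for i
    using assms(11) that J(1) unfolding x by (auto simp: sequence_over_def Zmod_def)
  have "\<not> has_cube_zero_sum n J x"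
    using assms(2,13) has_zero_sum_subsequence_image_mset[of n J x] J(1) unfolding x by simp
  then obtain p where p: "prime p" "p dvd n" "card {i\<in>J. \<not> p dvd x i} = prime_weight p"
    "\<not> has_cube_zero_sum (n div p) {i\<in>J. p dvd x i} (\<lambda>i. x i div p)"
    "\<not> has_cube_zero_sum p {i\<in>J. \<not> p dvd x i} x"
    using extremal_structure[OF adm assms(2) J] by blast
  note c = admissible_prime_cofactor[OF adm p(1,2)]
  have p0: "p > 0" using p(1) prime_gt_0_int by blast
  define K L where "K = {i\<in>J. \<not> p dvd x i}" and "L = {i\<in>J. p dvd x i}"
  have KL: "finite K" "finite L" "K \<inter> L = {}" "K \<union> L = J"
    using J(1) by (auto simp: K_def L_def)
  obtain ks ls where ks: "distinct ks" "set ks = K" and ls: "distinct ls" "set ls = L"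
    using finite_distinct_list KL(1,2) by metis
  \<comment> \<open>The terms prime to \<open>p\<close> come first, so that they take the positions
    named in the theorem.\<close>
  define xs where "xs = map x ks @ map x ls"
  define ys where "ys = map (\<lambda>i. x i div p) ls"
  have len: "length ks = prime_weight p"
    using ks p(3) distinct_card[of ks] by (simp add: K_def)
  have "mset ks + mset ls = mset_set J"
    using mset_set_Union[OF KL(1,2,3)] KL(4) mset_set_set[OF ks(1)] mset_set_set[OF ls(1)] ks(2) ls(2)
    by simp
  then have "mset xs = S" unfolding x xs_def by (simp flip: image_mset_union)
  then have equiv: "equivalent_sequences n (unit_cubes n) S (mset xs)"
    using equivalent_sequences_refl assms(2,11) by simp
  have "p dvd xs ! i \<longleftrightarrow> \<not> i < length ks" if "i < length xs" for i
  proof (cases "i < length ks")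
    case True
    then have "ks ! i \<in> K" using ks(2) nth_mem by blast
    then show ?thesis using True by (simp add: xs_def nth_append K_def)
  next
    case False
    then have "ls ! (i - length ks) \<in> L" using that ls(2) nth_mem by (auto simp: xs_def)
    then show ?thesis using False that by (simp add: xs_def nth_append L_def)
  qed
  then have nondiv: "{i. i < length xs \<and> \<not> p dvd xs ! i} = {..<prime_weight p}"
    using len by (auto simp: xs_def)
  have drop: "drop (prime_weight p) xs = map (\<lambda>y. p * y) ys"
    using len ls(2) by (simp add: xs_def ys_def L_def)
  have "card L = total_weight (n div p)"
    using J(2) c(6) p(3) KL card_Un_disjoint[of K L] by (simp add: K_def)
  moreover have "x i div p \<in> {0..<n div p}" if "i \<in> L" for i
  proof -
    have "x i \<in> {0..<n}" "p * (x i div p) = x i" "p * (n div p) = n"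
      using that x_range p(2) by (auto simp: L_def)
    then have "0 \<le> x i div p" "p * (x i div p) < p * (n div p)"
      using p0 by (auto simp: pos_imp_zdiv_nonneg_iff)
    then show ?thesis using p0 by (simp only: atLeastLessThan_iff mult_less_cancel_left_pos simp_thms)
  qed
  ultimately have "extremal_sequence (n div p) (unit_cubes (n div p))
      (image_mset (\<lambda>i. x i div p) (mset_set L))"
    using p(4)[folded L_def] by (intro extremal_sequence_image_mset c(3) KL(2))
  moreover have "mset ys = image_mset (\<lambda>i. x i div p) (mset_set L)"
    unfolding ys_def using ls by (metis mset_map mset_set_set)
  ultimately have ys: "extremal_sequence (n div p) (unit_cubes (n div p)) (mset ys)" by simp
  have "\<not> has_cube_zero_sum p K (\<lambda>i. x i mod p)"
    using p(5) has_cube_zero_sum_cong[of K K "\<lambda>i. x i mod p" x p] by (simp add: K_def)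
  \<comment> \<open>Here the modulus is \<open>p\<close> itself, and
    \<open>card K = prime_weight p = total_weight p\<close> is the extremal length.\<close>
  then have K: "extremal_sequence p (unit_cubes p) (image_mset (\<lambda>i. x i mod p) (mset_set K))"
    using p(3) KL(1) p0 total_weight_prime[OF p(1)]
    by (intro extremal_sequence_image_mset admissible_self c(2)) (simp_all add: K_def)
  show ?thesis
  proof (intro conjI exI[of _ xs] equiv)
    show "davenport n (unit_cubes n) - 1 = 2 * Omega n1 + Omega n2"
      unfolding dav unfolding assms(1) using assms(7-10) by (rule total_weight_eq_Omega)
    from cases[OF p(1,2)]
    show "(\<exists>p ys. prime p \<and> p dvd n1 \<and> {i. i < length xs \<and> \<not> p dvd xs ! i} = {0, 1} \<and>
          drop 2 xs = map (\<lambda>y. p * y) ys \<and>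
          extremal_sequence (n div p) (unit_cubes (n div p)) (mset ys) \<and>
          extremal_sequence p (unit_cubes p) {#xs ! 0 mod p, xs ! 1 mod p#}) \<or>
       (\<exists>p ys. prime p \<and> p dvd n2 \<and> {i. i < length xs \<and> \<not> p dvd xs ! i} = {0} \<and>
          drop 1 xs = map (\<lambda>y. p * y) ys \<and>
          extremal_sequence (n div p) (unit_cubes (n div p)) (mset ys))"
    proof
      assume p1: "p dvd n1 \<and> [p = 1] (mod 3)"
      then have w: "prime_weight p = 2" by (simp add: prime_weight_def cong_def)
      obtain i j where ij: "ks = [i, j]"
        using len w by (auto simp: numeral_2_eq_2 length_Suc_conv)
      have "mset_set K = {#i, j#}"
        using ks ij mset_set_set[OF ks(1)] by simp
      then have "image_mset (\<lambda>i. x i mod p) (mset_set K) = {#xs ! 0 mod p, xs ! 1 mod p#}"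
        by (simp add: xs_def ij)
      moreover have "{..<2} = {0, 1 :: nat}" by auto
      ultimately show ?thesis
        using p(1) p1 nondiv drop ys K unfolding w by (intro disjI1 exI[of _ p] exI[of _ ys]) simp
    next
      assume p2: "p dvd n2 \<and> [p = 2] (mod 3)"
      then have w: "prime_weight p = 1" by (simp add: prime_weight_def cong_def)
      have "{..<1} = {0 :: nat}" by auto
      then show ?thesis
        using p(1) p2 nondiv drop ys unfolding w by (intro disjI2 exI[of _ p] exI[of _ ys]) simp
    qed
  qed
qed

end
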